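(* Let $k\ge 0$ and $n\ge (k+1)^2$ be integers, and let $G$ be a nearly balanced bipartite graph on $2n-1$ vertices with minimum degree $\delta(G)\ge k$. (1) If $k\ge 1$ and $q(G)\ge q(S_n^k)$, then $G$ is traceable unless $G=S_n^k$. (2) If $k=0$, $n\ge 3$ and $q(G)\ge q(S_n^1)$, then $G$ is traceable unless $G=S_n^1$.
   Context: Graphs are finite and simple. A bipartite graph comes with a fixed bipartition $\{X,Y\}$ (parts may be empty); it is nearly balanced if the sizes of its two parts differ by exactly $1$ (the roles of the two parts may be interchanged). A graph is traceable if it contains a spanning path (Hamilton path). $q(G)$ is the signless Laplacian spectral radius, i.e. the largest eigenvalue of $D(G)+A(G)$, where $A(G)$ is the adjacency matrix and $D(G)$ the diagonal degree matrix. Equality of graphs is up to isomorphism (possibly interchanging the two parts). $K_{m,n}$ is the complete bipartite graph with parts of sizes $|X|=m$, $|Y|=n$, and $\varPhi_{m,n}$ is the edgeless bipartite graph with parts of sizes $|X|=m$, $|Y|=n$. For bipartite graphs $G_1,G_2$ with bipartitions $\{X_1,Y_1\}$, $\{X_2,Y_2\}$, $G_1\sqcup G_2$ is the graph obtained from the disjoint union $G_1\cup G_2$ by adding all edges between $X_1$ and $Y_2$ and all edges between $Y_1$ and $X_2$ (its parts are $X_1\cup X_2$ and $Y_1\cup Y_2$). Define $S_n^k=K_{k,n-k-1}\sqcup\varPhi_{n-k,k}$ for $1\le k\le (n-1)/2$. *)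

theory Defs
  imports
    "Graph_Theory.Digraph_Isomorphism"
    "Graph_Theory.Pair_Digraph"
    "Graph_Theory.Vertex_Walk"
    "Jordan_Normal_Form.Spectral_Radius"
begin

section \<open>Bipartite graphs with a fixed bipartition\<close>

text \<open>
  An edge is recorded once in \<open>bedges\<close>, as the pair of its end in \<open>left\<close> (the part $X$) and its
  end in \<open>right\<close> (the part $Y$). As usual for Graph_Theory, the underlying simple graph is the
  symmetric loop-free digraph that contains both orientations of every edge.
\<close>

record 'a bigraph =
  left :: "'a set"
  right :: "'a set"
  bedges :: "('a \<times> 'a) set"

definition bipartite_graph :: "'a bigraph \<Rightarrow> bool" where
  "bipartite_graph B \<longleftrightarrow> finite (left B) \<and> finite (right B) \<and> left B \<inter> right B = {} \<and>
     bedges B \<subseteq> left B \<times> right B"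

definition graph_of :: "'a bigraph \<Rightarrow> 'a pair_pre_digraph" where
  "graph_of B = \<lparr> pverts = left B \<union> right B, parcs = bedges B \<union> (bedges B)\<inverse> \<rparr>"

lemma pair_graph_graph_of:
  assumes "bipartite_graph B"
  shows "pair_graph (graph_of B)"
proof -
  have "finite (bedges B)"
    using assms unfolding bipartite_graph_def by (meson finite_SigmaI finite_subset)
  with assms show ?thesis
    unfolding bipartite_graph_def graph_of_def
    by unfold_locales (auto simp: symmetric_def sym_def)
qed

definition nearly_balanced :: "'a bigraph \<Rightarrow> bool" where
  "nearly_balanced B \<longleftrightarrow> card (left B) = card (right B) + 1 \<or> card (right B) = card (left B) + 1"

text \<open>Graph isomorphism that maps the bipartition to the bipartition, possibly interchanging the parts.\<close>

definition bigraph_iso :: "'a bigraph \<Rightarrow> 'b bigraph \<Rightarrow> bool" (infix \<open>\<cong>\<^sub>b\<close> 50) where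
  "B \<cong>\<^sub>b C \<longleftrightarrow>
     (\<exists>h. pre_digraph.digraph_isomorphism (with_proj (graph_of B)) h \<and>
          with_proj (graph_of C) = app_iso h (with_proj (graph_of B)) \<and>
          {iso_verts h ` left B, iso_verts h ` right B} = {left C, right C})"


section \<open>Minimum degree, traceability, signless Laplacian spectral radius\<close>

text \<open>In a symmetric digraph the out-degree of a vertex is its number of neighbours.\<close>

abbreviation vdegree :: "'a pair_pre_digraph \<Rightarrow> 'a \<Rightarrow> nat" where
  "vdegree G v \<equiv> out_degree (with_proj G) v"

definition min_degree :: "'a pair_pre_digraph \<Rightarrow> nat" where
  "min_degree G = Min (vdegree G ` pverts G)"

definition traceable :: "'a pair_pre_digraph \<Rightarrow> bool" where
  "traceable G \<longleftrightarrow> (\<exists>p. vpath p (with_proj G) \<and> set p = pverts G)"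

definition adjacency_mat :: "'a list \<Rightarrow> 'a pair_pre_digraph \<Rightarrow> real mat" where
  "adjacency_mat vs G = mat (length vs) (length vs)
     (\<lambda>(i, j). if (vs ! i, vs ! j) \<in> parcs G then 1 else 0)"

definition degree_mat :: "'a list \<Rightarrow> 'a pair_pre_digraph \<Rightarrow> real mat" where
  "degree_mat vs G = mat (length vs) (length vs)
     (\<lambda>(i, j). if i = j then real (vdegree G (vs ! i)) else 0)"

text \<open>
  Matrices are indexed by natural numbers, so the vertices have to be listed in some order. The
  spectrum does not depend on the order (see \<open>eigenvalue_signless_laplacian_iff\<close>).
\<close>

definition signless_laplacian :: "'a list \<Rightarrow> 'a pair_pre_digraph \<Rightarrow> real mat" where
  "signless_laplacian vs G = degree_mat vs G + adjacency_mat vs G"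

definition vertex_list :: "'a pair_pre_digraph \<Rightarrow> 'a list" where
  "vertex_list G = (SOME vs. distinct vs \<and> set vs = pverts G)"

definition q_radius :: "'a pair_pre_digraph \<Rightarrow> real" where
  "q_radius G = Max (spectrum (signless_laplacian (vertex_list G) G))"

lemma vertex_list:
  assumes "finite (pverts G)"
  shows "distinct (vertex_list G)" "set (vertex_list G) = pverts G"
proof -
  have "\<exists>vs. distinct vs \<and> set vs = pverts G"
    using finite_distinct_list[OF assms] by blast
  from someI_ex[OF this] show "distinct (vertex_list G)" "set (vertex_list G) = pverts G"
    by (simp_all add: vertex_list_def)
qed

lemma signless_laplacian_mult_nth:
  assumes vs: "distinct vs" and i: "i < length vs" and f: "f \<in> carrier_vec (length vs)"
    and fg: "\<And>j. j < length vs \<Longrightarrow> f $ j = g (vs ! j)"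
  shows "(signless_laplacian vs G *\<^sub>v f) $ i =
    real (vdegree G (vs ! i)) * g (vs ! i) + (\<Sum>u\<in>{u\<in>set vs. (vs ! i, u) \<in> parcs G}. g u)"
proof -
  let ?n = "length vs"
  have bij: "bij_betw ((!) vs) {0..<?n} (set vs)"
    using bij_betw_nth[OF vs] by (simp add: atLeast0LessThan)
  have "(signless_laplacian vs G *\<^sub>v f) $ i =
      (\<Sum>j = 0..<?n. ((if i = j then real (vdegree G (vs ! i)) else 0)
        + (if (vs ! i, vs ! j) \<in> parcs G then 1 else 0)) * g (vs ! j))"
    using i f fg
    by (auto simp: signless_laplacian_def degree_mat_def adjacency_mat_def scalar_prod_def
        simp del: sum.distrib intro!: sum.cong)
  also have "\<dots> = (\<Sum>j = 0..<?n. (if i = j then real (vdegree G (vs ! i)) * g (vs ! i) else 0)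
        + (if (vs ! i, vs ! j) \<in> parcs G then g (vs ! j) else 0))"
    by (rule sum.cong) (auto simp: distrib_right)
  also have "\<dots> = real (vdegree G (vs ! i)) * g (vs ! i)
      + (\<Sum>j = 0..<?n. if (vs ! i, vs ! j) \<in> parcs G then g (vs ! j) else 0)"
    using i by (simp add: sum.distrib)
  also have "(\<Sum>j = 0..<?n. if (vs ! i, vs ! j) \<in> parcs G then g (vs ! j) else 0)
      = (\<Sum>u\<in>set vs. if (vs ! i, u) \<in> parcs G then g u else 0)"
    using sum.reindex_bij_betw[OF bij, of "\<lambda>u. if (vs ! i, u) \<in> parcs G then g u else 0"] .
  also have "\<dots> = (\<Sum>u\<in>{u\<in>set vs. (vs ! i, u) \<in> parcs G}. g u)"
    by (rule sum.inter_filter[symmetric]) simp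
  finally show ?thesis .
qed

lemma eigenvalue_signless_laplacian_iff:
  assumes vs: "distinct vs"
  shows "eigenvalue (signless_laplacian vs G) x \<longleftrightarrow>
    (\<exists>g. (\<exists>v\<in>set vs. g v \<noteq> 0) \<and>
      (\<forall>v\<in>set vs. real (vdegree G v) * g v + (\<Sum>u\<in>{u\<in>set vs. (v, u) \<in> parcs G}. g u) = x * g v))"
    (is "?L \<longleftrightarrow> (\<exists>g. ?R g)")
proof
  let ?n = "length vs"
  have dim: "dim_row (signless_laplacian vs G) = ?n"
    by (simp add: signless_laplacian_def adjacency_mat_def)
  {
    assume ?L
    then obtain f where f: "f \<in> carrier_vec ?n" "f \<noteq> 0\<^sub>v ?n"
      and eq: "signless_laplacian vs G *\<^sub>v f = x \<cdot>\<^sub>v f"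
      by (auto simp: eigenvalue_def eigenvector_def dim)
    define g where "g v = f $ (the_inv_into {..<?n} ((!) vs) v)" for v
    have g: "f $ j = g (vs ! j)" if "j < ?n" for j
      using that vs by (simp add: g_def the_inv_into_f_f inj_on_nth)
    obtain j where j: "j < ?n" "f $ j \<noteq> 0"
      using f by (metis carrier_vecD eq_vecI index_zero_vec(1,2))
    have "\<exists>v\<in>set vs. g v \<noteq> 0" using j g by (metis nth_mem)
    moreover have "real (vdegree G v) * g v + (\<Sum>u\<in>{u\<in>set vs. (v, u) \<in> parcs G}. g u) = x * g v"
      if v: "v \<in> set vs" for v
    proof -
      obtain i where i: "i < ?n" "v = vs ! i" using v by (metis in_set_conv_nth)
      have "(signless_laplacian vs G *\<^sub>v f) $ i = x * g v"
        using i f g eq by simp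
      with signless_laplacian_mult_nth[OF vs i(1) f(1) g] i show ?thesis by simp
    qed
    ultimately show "\<exists>g. ?R g" by blast
  next
    assume "\<exists>g. ?R g"
    then obtain g where R: "?R g" ..
    define f where "f = vec ?n (\<lambda>j. g (vs ! j))"
    have f: "f \<in> carrier_vec ?n" by (simp add: f_def)
    have g: "f $ j = g (vs ! j)" if "j < ?n" for j using that by (simp add: f_def)
    obtain j where j: "j < ?n" "g (vs ! j) \<noteq> 0" using R by (metis in_set_conv_nth)
    have "f \<noteq> 0\<^sub>v ?n" using j g by auto
    moreover have "signless_laplacian vs G *\<^sub>v f = x \<cdot>\<^sub>v f"
    proof (rule eq_vecI)
      fix i assume "i < dim_vec (x \<cdot>\<^sub>v f)"
      then have i: "i < ?n" by (simp add: f_def)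
      with R signless_laplacian_mult_nth[OF vs i f g]
      show "(signless_laplacian vs G *\<^sub>v f) $ i = (x \<cdot>\<^sub>v f) $ i"
        using f g by simp
    qed (simp add: f_def dim)
    ultimately show ?L using f by (auto simp: eigenvalue_def eigenvector_def dim)
  }
qed


section \<open>The graphs \<open>S\<^sub>n\<^sup>k\<close>\<close>

definition complete_bigraph :: "nat \<Rightarrow> nat \<Rightarrow> (nat + nat) bigraph" where
  "complete_bigraph m n =
     \<lparr> left = Inl ` {..<m}, right = Inr ` {..<n}, bedges = Inl ` {..<m} \<times> Inr ` {..<n} \<rparr>"

definition edgeless_bigraph :: "nat \<Rightarrow> nat \<Rightarrow> (nat + nat) bigraph" where
  "edgeless_bigraph m n = \<lparr> left = Inl ` {..<m}, right = Inr ` {..<n}, bedges = {} \<rparr>"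

definition bigraph_join :: "'a bigraph \<Rightarrow> 'b bigraph \<Rightarrow> ('a + 'b) bigraph" (infixl \<open>\<squnion>\<^sub>b\<close> 65) where
  "B \<squnion>\<^sub>b C =
     \<lparr> left = Inl ` left B \<union> Inr ` left C,
       right = Inl ` right B \<union> Inr ` right C,
       bedges = map_prod Inl Inl ` bedges B \<union> map_prod Inr Inr ` bedges C \<union>
         Inl ` left B \<times> Inr ` right C \<union> Inr ` left C \<times> Inl ` right B \<rparr>"

text \<open>Only meant for \<open>1 \<le> k \<le> (n - 1) / 2\<close>, where the subtractions do not truncate.\<close>

definition S_graph :: "nat \<Rightarrow> nat \<Rightarrow> ((nat + nat) + (nat + nat)) bigraph" where
  "S_graph n k = complete_bigraph k (n - k - 1) \<squnion>\<^sub>b edgeless_bigraph (n - k) k"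

lemma bipartite_graph_S_graph: "bipartite_graph (S_graph n k)"
  by (auto simp: bipartite_graph_def S_graph_def bigraph_join_def complete_bigraph_def
      edgeless_bigraph_def)

end

theory Submission
  imports Defs
begin

text \<open>
  Orient \<open>G\<close> so that \<open>card X = n\<close> and \<open>card Y = n - 1\<close>. The test function \<open>f = deg\<close> bounds every
  eigenvalue of the signless Laplacian by \<open>n + e(G) / n\<close>, while \<open>q(S\<^sub>n\<^sup>k) > 2 n - k - 1\<close>; hence
  \<open>e(G) > n (n - k - 1)\<close>, so fewer than \<open>n k\<close> pairs of \<open>X \<times> Y\<close> are non-adjacent. If \<open>G\<close> is not
  traceable, then, by a Bondy--Chvatal closure argument, an edge-maximal non-traceable \<open>F \<supseteq> G\<close> has
  bipartite complement \<open>H\<close> in which the end degrees of every edge add up to at least \<open>n\<close>. With so few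
  edges and the degree bounds coming from \<open>\<delta>(G) \<ge> k\<close>, \<open>H\<close> can only be \<open>K\<^sub>n\<^sub>-\<^sub>k\<^sub>,\<^sub>k\<close>, that is,
  \<open>G \<subseteq> F = S\<^sub>n\<^sup>k\<close>. As \<open>S\<^sub>n\<^sup>k\<close> is connected, a proper spanning subgraph has a strictly smaller
  signless Laplacian spectral radius, so \<open>G = S\<^sub>n\<^sup>k\<close>. For \<open>k = 0\<close>, an isolated vertex would force
  \<open>q(G) \<le> 2 n - 2 < q(S\<^sub>n\<^sup>1)\<close>, so the argument for \<open>k = 1\<close> applies.
\<close>


section \<open>Closure for Hamilton cycles in bipartite graphs\<close>

text \<open>Edges stay oriented from \<open>X\<close> to \<open>Y\<close>, so that images under
  \<open>E\<close> and under its converse are neighbourhoods; walks and spectra use the symmetric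
  closure.\<close>

definition sym_edges :: "'a rel \<Rightarrow> 'a rel" where
  "sym_edges E = E \<union> E\<inverse>"

lemma sym_edges_swap: "(u, v) \<in> sym_edges E \<longleftrightarrow> (v, u) \<in> sym_edges E"
  by (auto simp: sym_edges_def)

lemma successively_rev_sym_edges:
  "successively (\<lambda>u v. (u, v) \<in> sym_edges E) (rev xs) \<longleftrightarrow>
   successively (\<lambda>u v. (u, v) \<in> sym_edges E) xs"
  unfolding successively_rev by (rule arg_cong[of _ _ "\<lambda>P. successively P xs"]) (auto simp: sym_edges_def fun_eq_iff)

text \<open>A single edge, as a list of two vertices, counts as a cycle. With the apex introduced
  below this covers \<open>card X = 1\<close>, where the smaller part is empty.\<close>

definition hamiltonian_cycle :: "'a rel \<Rightarrow> 'a set \<Rightarrow> 'a list \<Rightarrow> bool" where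
  "hamiltonian_cycle A V C \<longleftrightarrow> C \<noteq> [] \<and> distinct C \<and> set C = V \<and>
     successively (\<lambda>u v. (u, v) \<in> A) C \<and> (last C, hd C) \<in> A"

definition hamiltonian_path :: "'a rel \<Rightarrow> 'a set \<Rightarrow> 'a list \<Rightarrow> bool" where
  "hamiltonian_path A V p \<longleftrightarrow> p \<noteq> [] \<and> distinct p \<and> set p = V \<and> successively (\<lambda>u v. (u, v) \<in> A) p"

lemma hamiltonian_cycle_rotate:
  assumes "hamiltonian_cycle A V (P @ R)"
  shows "hamiltonian_cycle A V (R @ P)"
proof (cases "P = [] \<or> R = []")
  case True
  then show ?thesis using assms by auto
next
  case False
  then show ?thesis using assms
    by (auto simp: hamiltonian_cycle_def successively_append_iff)
qed

lemma hamiltonian_cycle_rev: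
  assumes "hamiltonian_cycle (sym_edges E) V C"
  shows "hamiltonian_cycle (sym_edges E) V (rev C)"
  using assms sym_edges_swap[of "last C" "hd C" E]
  by (simp add: hamiltonian_cycle_def hd_rev last_rev successively_rev_sym_edges del: successively_rev)

lemma not_successivelyE:
  assumes "\<not> successively P xs"
  obtains U u w R where "xs = U @ [u, w] @ R" "\<not> P u w"
  using assms
proof (induction xs arbitrary: thesis)
  case (Cons a xs)
  show ?case
  proof (cases "successively P xs")
    case True
    with Cons.prems(2) have "xs \<noteq> []" "\<not> P a (hd xs)"
      by (auto simp: successively_Cons)
    then show ?thesis
      using Cons.prems(1)[of "[]" a "hd xs" "tl xs"] by simp
  next
    case False
    with Cons.IH obtain U u w R where "xs = U @ [u, w] @ R" "\<not> P u w" by blast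
    then show ?thesis using Cons.prems(1)[of "a # U" u w R] by simp
  qed
qed simp

text \<open>Walk from the first vertex to \<open>u\<close>, jump to the last vertex, walk back to
  \<open>w\<close> and close up: two crossing chords replace the path edge between \<open>u\<close>
  and \<open>w\<close>.\<close>

lemma hamiltonian_cycle_crossing:
  assumes "hamiltonian_path (sym_edges E) V (U @ [u, w] @ R)"
    and "(hd (U @ [u]), w) \<in> sym_edges E" "(last (w # R), u) \<in> sym_edges E"
  shows "hamiltonian_cycle (sym_edges E) V ((U @ [u]) @ rev (w # R))"
proof -
  have s: "successively (\<lambda>u v. (u, v) \<in> sym_edges E) ((U @ [u]) @ (w # R))"
    using assms(1) by (simp add: hamiltonian_path_def)
  have "successively (\<lambda>u v. (u, v) \<in> sym_edges E) (rev (w # R))"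
    using s unfolding successively_append_iff successively_rev_sym_edges by blast
  moreover have "successively (\<lambda>u v. (u, v) \<in> sym_edges E) (U @ [u])"
    using s unfolding successively_append_iff by blast
  moreover have "(u, last (w # R)) \<in> sym_edges E"
    using assms(3) by (rule sym_edges_swap[THEN iffD1])
  moreover have "hd (rev (w # R)) = last (w # R)" "last (U @ [u]) = u"
    by (simp_all only: hd_rev last_snoc)
  ultimately have "successively (\<lambda>u v. (u, v) \<in> sym_edges E) ((U @ [u]) @ rev (w # R))"
    unfolding successively_append_iff by metis
  moreover have "(last ((U @ [u]) @ rev (w # R)), hd ((U @ [u]) @ rev (w # R))) \<in> sym_edges E"
    using assms(2)[THEN sym_edges_swap[THEN iffD1]] by (cases U) simp_all
  moreover have "distinct ((U @ [u]) @ rev (w # R))" "set ((U @ [u]) @ rev (w # R)) = V"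
    using assms(1) by (auto simp: hamiltonian_path_def)
  ultimately show ?thesis unfolding hamiltonian_cycle_def by blast
qed

text \<open>Bondy-Chvatal step: removing the edge between \<open>x\<close> and \<open>y\<close> from
  the cycle leaves a Hamilton path of \<open>E\<close>. On it the predecessors of the neighbours of
  \<open>x\<close> lie in \<open>X\<close>, so the degree condition makes one of them a neighbour of
  \<open>y\<close>, and crossing chords close a cycle inside \<open>E\<close>.\<close>

lemma hamiltonian_cycle_closure:
  assumes fin: "finite X" and disj: "X \<inter> Y = {}" and E: "E \<subseteq> X \<times> Y"
    and x: "x \<in> X" and y: "y \<in> Y"
    and deg: "card X < card (E `` {x}) + card (E\<inverse> `` {y})"
    and C: "hamiltonian_cycle (sym_edges (insert (x, y) E)) (X \<union> Y) C"
  shows "\<exists>C. hamiltonian_cycle (sym_edges E) (X \<union> Y) C"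
proof (rule ccontr)
  assume no: "\<not> ?thesis"
  let ?E' = "insert (x, y) E"
  have xy: "x \<noteq> y" using x y disj by auto
  \<comment> \<open>Some cyclically consecutive pair of \<open>C\<close> is missing from
    \<open>E\<close>; rotating makes it the closing pair, which must then consist of
    \<open>x\<close> and \<open>y\<close>.\<close>
  have "\<exists>Q. hamiltonian_cycle (sym_edges ?E') (X \<union> Y) Q \<and> (last Q, hd Q) \<notin> sym_edges E"
  proof (cases "(last C, hd C) \<in> sym_edges E")
    case True
    with no C have "\<not> successively (\<lambda>u v. (u, v) \<in> sym_edges E) C"
      by (auto simp: hamiltonian_cycle_def)
    then obtain U u w R where "C = U @ [u, w] @ R" and uw: "(u, w) \<notin> sym_edges E"
      by (rule not_successivelyE) auto
    with C have "hamiltonian_cycle (sym_edges ?E') (X \<union> Y) ((U @ [u]) @ (w # R))" by simp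
    from hamiltonian_cycle_rotate[OF this] uw show ?thesis
      by (intro exI[of _ "(w # R) @ (U @ [u])"]) simp
  qed (use C in blast)
  then obtain Q0 where Q0: "hamiltonian_cycle (sym_edges ?E') (X \<union> Y) Q0"
    and n0: "(last Q0, hd Q0) \<notin> sym_edges E" by blast
  have ends: "(last Q0 = x \<and> hd Q0 = y) \<or> (last Q0 = y \<and> hd Q0 = x)"
    using Q0 n0 by (auto simp: hamiltonian_cycle_def sym_edges_def)
  obtain Q where Q: "hamiltonian_cycle (sym_edges ?E') (X \<union> Y) Q"
    and hd: "hd Q = x" and last: "last Q = y"
  proof (cases "hd Q0 = x")
    case True
    then show ?thesis using that Q0 ends xy by blast
  next
    case False
    then show ?thesis using that[OF hamiltonian_cycle_rev[OF Q0]] ends Q0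
      by (auto simp: hd_rev last_rev hamiltonian_cycle_def)
  qed
  have Qne: "Q \<noteq> []" and Qd: "distinct Q" and Qs: "set Q = X \<union> Y"
    using Q by (auto simp: hamiltonian_cycle_def)
  \<comment> \<open>On two vertices the new edge would be used in both directions, and removing it
    would leave no path. But then \<open>E\<close> is empty, against the degree condition.\<close>
  have len: "length Q \<noteq> 2"
  proof
    assume "length Q = 2"
    then obtain a b where "Q = [a, b]" by (auto simp: numeral_2_eq_2 length_Suc_conv)
    then have "X \<union> Y = {x, y}" using hd last Qs by auto
    then have XY: "X = {x}" "Y = {y}" using x y disj by auto
    have "(x, y) \<notin> E" using n0 ends by (auto simp: sym_edges_def)
    then have "E = {}" using E XY by auto
    then show False using deg by simp
  qed
  \<comment> \<open>Distinctness and \<open>len\<close> keep the closing pair from also occurring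
    inside \<open>Q\<close>, so every inner step is in \<open>E\<close>.\<close>
  have path: "hamiltonian_path (sym_edges E) (X \<union> Y) Q"
    unfolding hamiltonian_path_def successively_conv_nth
  proof (intro conjI allI impI Qne Qd Qs)
    fix i assume i: "Suc i < length Q"
    have a: "(Q ! i, Q ! Suc i) \<in> sym_edges ?E'"
      using Q i by (auto simp: hamiltonian_cycle_def successively_conv_nth)
    have "\<not> (Q ! i = x \<and> Q ! Suc i = y)"
      using i len Qd Qne hd last
      by (auto simp: hd_conv_nth last_conv_nth nth_eq_iff_index_eq)
    moreover have "\<not> (Q ! i = y \<and> Q ! Suc i = x)"
      using i Qd Qne hd
      by (auto simp: hd_conv_nth nth_eq_iff_index_eq)
    ultimately show "(Q ! i, Q ! Suc i) \<in> sym_edges E"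
      using a by (auto simp: sym_edges_def)
  qed
  have "\<exists>i. Suc i < length Q \<and> Q ! Suc i = w" if "w \<in> E `` {x}" for w
  proof -
    have "w \<in> Y" using that E by auto
    then have "w \<in> set Q" "w \<noteq> x" using Qs x disj by auto
    then obtain j where "j < length Q" "Q ! j = w" by (meson in_set_conv_nth)
    moreover have "j \<noteq> 0" using hd \<open>w \<noteq> x\<close> calculation Qne by (metis hd_conv_nth)
    ultimately show ?thesis by (metis not0_implies_Suc)
  qed
  then obtain idx where idx: "Suc (idx w) < length Q" "Q ! Suc (idx w) = w"
    if "w \<in> E `` {x}" for w by metis
  let ?pred = "\<lambda>w. Q ! idx w"
  have inj: "inj_on ?pred (E `` {x})"
  proof (rule inj_onI)
    fix v w assume "v \<in> E `` {x}" "w \<in> E `` {x}" "?pred v = ?pred w"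
    moreover from this have "idx v = idx w"
      using idx Qd by (metis Suc_lessD nth_eq_iff_index_eq)
    ultimately show "v = w" using idx by metis
  qed
  have sub: "?pred ` (E `` {x}) \<subseteq> X"
  proof
    fix u assume "u \<in> ?pred ` (E `` {x})"
    then obtain w where w: "w \<in> E `` {x}" "u = ?pred w" by blast
    have "(?pred w, w) \<in> sym_edges E"
      using path idx[OF w(1)] unfolding hamiltonian_path_def successively_conv_nth by metis
    moreover have "w \<in> Y" using w E by auto
    ultimately show "u \<in> X" using w E disj by (auto simp: sym_edges_def)
  qed
  have sub2: "E\<inverse> `` {y} \<subseteq> X" using E by auto
  \<comment> \<open>Pigeonhole: both sets lie in \<open>X\<close>, and their sizes add up to more
    than \<open>card X\<close>.\<close>
  have "?pred ` (E `` {x}) \<inter> E\<inverse> `` {y} \<noteq> {}"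
  proof
    assume "?pred ` (E `` {x}) \<inter> E\<inverse> `` {y} = {}"
    then have "card (?pred ` (E `` {x})) + card (E\<inverse> `` {y}) = card (?pred ` (E `` {x}) \<union> E\<inverse> `` {y})"
      using sub sub2 fin by (metis card_Un_disjoint finite_subset)
    also have "\<dots> \<le> card X" using sub sub2 fin by (simp add: card_mono)
    finally show False using deg card_image[OF inj] by simp
  qed
  then obtain w where w: "w \<in> E `` {x}" "(?pred w, y) \<in> E" by auto
  define U u R where "U = take (idx w) Q" and "u = ?pred w" and "R = drop (Suc (Suc (idx w))) Q"
  have "Q = U @ u # drop (Suc (idx w)) Q"
    using idx[OF w(1)] by (simp add: U_def u_def id_take_nth_drop[symmetric])
  also have "drop (Suc (idx w)) Q = w # R"
    using idx[OF w(1)] by (simp add: R_def Cons_nth_drop_Suc[symmetric])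
  finally have dec: "Q = U @ [u, w] @ R" by simp
  have "hd (U @ [u]) = x"
    using hd unfolding dec by (cases U) simp_all
  moreover have "last (w # R) = y"
    using last unfolding dec by simp
  moreover have "(x, w) \<in> sym_edges E" "(y, u) \<in> sym_edges E"
    using w by (simp_all add: sym_edges_def u_def)
  ultimately have "hamiltonian_cycle (sym_edges E) (X \<union> Y) ((U @ [u]) @ rev (w # R))"
    using path dec by (intro hamiltonian_cycle_crossing) simp_all
  then show False using no by blast
qed

text \<open>Pair the vertices of the two parts arbitrarily and run through the pairs
  alternately.\<close>

lemma complete_bipartite_hamiltonian_cycle:
  assumes "finite X" "finite Y" "X \<inter> Y = {}" "card X = card Y" "X \<noteq> {}"
  shows "\<exists>C. hamiltonian_cycle (sym_edges (X \<times> Y)) (X \<union> Y) C"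
proof -
  \<comment> \<open>The invariant on the ends does two jobs: a head in \<open>X\<close> lets the
    next pair be prepended, and a last vertex in \<open>Y\<close> closes the cycle.\<close>
  have *: "xs = [] \<or> (\<exists>C. C \<noteq> [] \<and> set C = set xs \<union> set ys \<and> distinct C \<and>
      successively (\<lambda>u v. (u, v) \<in> sym_edges (X \<times> Y)) C \<and> hd C \<in> X \<and> last C \<in> Y)"
    if "length xs = length ys" "distinct xs" "distinct ys" "set xs \<subseteq> X" "set ys \<subseteq> Y" for xs ys
    using that
  proof (induction xs ys rule: list_induct2)
    case (Cons x xs y ys)
    show ?case
    proof (cases "xs = []")
      case True
      then show ?thesis using Cons assms(3)
        by (intro disjI2 exI[of _ "[x, y]"]) (auto simp: sym_edges_def)
    next
      case False
      with Cons obtain C where "C \<noteq> []" "set C = set xs \<union> set ys" "distinct C"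
        "successively (\<lambda>u v. (u, v) \<in> sym_edges (X \<times> Y)) C" "hd C \<in> X" "last C \<in> Y" by auto
      then show ?thesis using Cons.prems assms(3)
        by (intro disjI2 exI[of _ "x # y # C"]) (auto simp: sym_edges_def successively_Cons)
    qed
  qed simp
  obtain xs ys where "distinct xs" "set xs = X" "distinct ys" "set ys = Y"
    using assms finite_distinct_list by metis
  moreover from this assms have "length xs = length ys" "xs \<noteq> []"
    using distinct_card[of xs] distinct_card[of ys] by auto
  ultimately obtain C where "C \<noteq> []" "set C = X \<union> Y" "distinct C"
    "successively (\<lambda>u v. (u, v) \<in> sym_edges (X \<times> Y)) C" "hd C \<in> X" "last C \<in> Y"
    using *[of xs ys] by auto
  then show ?thesis by (auto simp: hamiltonian_cycle_def sym_edges_def)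
qed

text \<open>Adding an apex \<^const>\<open>None\<close> on the smaller side turns Hamilton paths of a nearly balanced
  graph into Hamilton cycles of a balanced one.\<close>

definition apex :: "'a set \<Rightarrow> 'a rel \<Rightarrow> 'a option rel" where
  "apex X E = map_prod Some Some ` E \<union> Some ` X \<times> {None}"

lemma apex_insert: "apex X (insert (x, y) E) = insert (Some x, Some y) (apex X E)"
  by (simp add: apex_def)

text \<open>Rotating the apex to the front and dropping it leaves a list of \<open>Some\<close>
  vertices, hence a path of \<open>E\<close>.\<close>

lemma hamiltonian_path_of_apex_cycle:
  assumes "hamiltonian_cycle (sym_edges (apex X E)) (Some ` V \<union> {None}) C" "V \<noteq> {}"
  shows "\<exists>p. hamiltonian_path (sym_edges E) V p"
proof -
  have "None \<in> set C" using assms by (auto simp: hamiltonian_cycle_def)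
  then obtain P R where C: "C = P @ None # R" by (meson split_list)
  have "hamiltonian_cycle (sym_edges (apex X E)) (Some ` V \<union> {None}) ((None # R) @ P)"
    using assms hamiltonian_cycle_rotate C by blast
  then have L: "distinct (None # (R @ P))" "set (None # (R @ P)) = Some ` V \<union> {None}"
    "successively (\<lambda>u v. (u, v) \<in> sym_edges (apex X E)) (None # (R @ P))"
    by (auto simp: hamiltonian_cycle_def)
  have "None \<notin> set (R @ P)" using L(1) by simp
  then obtain p where p: "R @ P = map Some p"
    by (metis ex_map_conv not_None_eq)
  have s: "Some ` set p = Some ` V" using L(1,2) p by auto
  then have "set p = V" by (auto simp: inj_image_eq_iff)
  moreover have "distinct p" using L(1) p by (simp add: distinct_map)
  moreover have "successively (\<lambda>u v. (Some u, Some v) \<in> sym_edges (apex X E)) p"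
    using L(3) p unfolding p by (simp add: successively_Cons successively_map) auto
  then have "successively (\<lambda>u v. (u, v) \<in> sym_edges E) p"
    by (rule successively_mono) (auto simp: sym_edges_def apex_def)
  ultimately show ?thesis using assms(2) by (auto simp: hamiltonian_path_def)
qed

text \<open>Maximality is taken among the supergraphs whose apex extension is not Hamiltonian, so
  that the closure step applies directly to the balanced extension.\<close>

lemma maximal_nontraceable_supergraph:
  fixes X Y :: "'a set"
  assumes fin: "finite X" "finite Y" and disj: "X \<inter> Y = {}" and card: "card X = card Y + 1"
    and E: "E \<subseteq> X \<times> Y"
    and nopath: "\<nexists>p. hamiltonian_path (sym_edges E) (X \<union> Y) p"
  obtains F where "E \<subseteq> F" "F \<subset> X \<times> Y"
    "\<And>x y. x \<in> X \<Longrightarrow> y \<in> Y \<Longrightarrow> (x, y) \<notin> F \<Longrightarrow> card (F `` {x}) + card (F\<inverse> `` {y}) < card X"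
proof -
  let ?X = "Some ` X" and ?Y = "insert None (Some ` Y)"
  define ham where
    "ham F \<longleftrightarrow> (\<exists>C. hamiltonian_cycle (sym_edges (apex X F)) (?X \<union> ?Y) C)" for F
  let ?S = "{F. E \<subseteq> F \<and> F \<subseteq> X \<times> Y \<and> \<not> ham F}"
  have V: "?X \<union> ?Y = Some ` (X \<union> Y) \<union> {None}" by auto
  have Xne: "X \<noteq> {}" using card by auto
  have "\<not> ham E"
    using nopath hamiltonian_path_of_apex_cycle[of X E "X \<union> Y"] Xne unfolding ham_def V by blast
  then have ES: "E \<in> ?S" using E by simp
  have "finite ?S"
    by (rule finite_subset[of _ "Pow (X \<times> Y)"]) (use fin in auto)
  from finite_has_maximal2[OF this ES] obtain F
    where F: "E \<subseteq> F" "F \<subseteq> X \<times> Y" "\<not> ham F" and max: "\<forall>F'\<in>?S. F \<subseteq> F' \<longrightarrow> F = F'"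
    by (elim bexE conjE CollectE)
  have finF: "finite (F `` {x})" for x
    using F(2) by (intro finite_subset[OF _ fin(2)]) auto
  have cXY: "finite ?X" "?X \<inter> ?Y = {}" "apex X F \<subseteq> ?X \<times> ?Y"
    using fin disj F(2) by (auto simp: apex_def)
  have full: "apex X (X \<times> Y) = ?X \<times> ?Y" by (auto simp: apex_def)
  have bal: "card ?X = card ?Y"
    using fin card by (simp add: card_image)
  have "ham (X \<times> Y)"
    unfolding ham_def full
    by (rule complete_bipartite_hamiltonian_cycle[OF cXY(1) _ cXY(2) bal])
      (use fin Xne in simp_all)
  then have "F \<noteq> X \<times> Y" using F(3) by auto
  moreover have "card (F `` {x}) + card (F\<inverse> `` {y}) < card X"
    if xy: "x \<in> X" "y \<in> Y" "(x, y) \<notin> F" for x y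
  proof (rule ccontr)
    assume ge: "\<not> ?thesis"
    \<comment> \<open>The apex is adjacent to all of \<open>X\<close>: it adds one to the degree of
      \<open>x\<close> and nothing to that of \<open>y\<close>. The threshold for the degree sum
      thus drops from more than \<open>card X\<close> to at least \<open>card X\<close>.\<close>
    have "apex X F `` {Some x} = insert None (Some ` (F `` {x}))"
      using xy by (auto simp: apex_def)
    then have c1: "card (apex X F `` {Some x}) = card (F `` {x}) + 1"
      using finF[of x] by (simp add: card_image)
    have "(apex X F)\<inverse> `` {Some y} = Some ` (F\<inverse> `` {y})"
      by (auto simp: apex_def)
    then have "card ((apex X F)\<inverse> `` {Some y}) = card (F\<inverse> `` {y})"
      by (simp add: card_image)
    with ge c1 have d: "card ?X < card (apex X F `` {Some x}) + card ((apex X F)\<inverse> `` {Some y})"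
      by (simp add: card_image)
    have "\<not> ham (insert (x, y) F)"
    proof
      assume "ham (insert (x, y) F)"
      then obtain C where "hamiltonian_cycle (sym_edges (insert (Some x, Some y) (apex X F))) (?X \<union> ?Y) C"
        unfolding ham_def apex_insert by blast
      from hamiltonian_cycle_closure[OF cXY _ _ d this] xy F(3) show False
        unfolding ham_def by blast
    qed
    then have "insert (x, y) F \<in> ?S" using F xy by auto
    from bspec[OF max this] xy(3) show False by auto
  qed
  ultimately show ?thesis using F(1,2) by (intro that) auto
qed

section \<open>Bipartite complements of maximal non-traceable graphs\<close>

lemma card_rel_eq_sum_Image:
  assumes "finite R"
  shows "card R = (\<Sum>x\<in>Domain R. card (R `` {x}))"
proof -
  have "R = Sigma (Domain R) (\<lambda>x. R `` {x})" by auto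
  moreover have "finite (R `` {x})" for x
    using assms by (auto intro: finite_Image)
  ultimately show ?thesis
    using card_SigmaI[of "Domain R" "\<lambda>x. R `` {x}"] assms by (simp add: finite_Domain)
qed

lemma card_rel_ge_sum_Image:
  assumes "finite R" "finite A"
  shows "(\<Sum>x\<in>A. card (R `` {x})) \<le> card R"
proof -
  have "Sigma A (\<lambda>x. R `` {x}) \<subseteq> R" by auto
  moreover have "finite (R `` {x})" for x
    using assms by (auto intro: finite_Image)
  ultimately show ?thesis
    using card_SigmaI[of A "\<lambda>x. R `` {x}"] assms card_mono[OF assms(1)] by metis
qed

text \<open>Let \<open>x\<close> have degree \<open>b > 0\<close> in \<open>H\<close>. Its
  neighbours have degree at least \<open>n - b\<close>, so \<open>H\<close> has at least
  \<open>b * (n - b)\<close> edges, which \<open>few\<close> and \<open>conc\<close> allow only for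
  \<open>b = k\<close>. Then every non-isolated \<open>y\<close> has degree \<open>n - k\<close>,
  and counting edges leaves at most \<open>k\<close> such \<open>y\<close>, so every non-isolated
  \<open>x\<close> is joined to all of them.\<close>

lemma product_of_heavy_edges:
  fixes H :: "('a \<times> 'b) set" and n k :: nat
  assumes fin: "finite H" and ne: "H \<noteq> {}" and kn: "k \<le> n"
    and heavy: "\<And>x y. (x, y) \<in> H \<Longrightarrow> n \<le> card (H `` {x}) + card (H\<inverse> `` {y})"
    and left: "\<And>x. card (H `` {x}) < n - k"
    and right: "\<And>y. card (H\<inverse> `` {y}) \<le> n - k"
    and few: "card H < n * k"
    and conc: "\<And>b. k < b \<Longrightarrow> b < n - k \<Longrightarrow> n * k \<le> b * (n - b)"
    and wide: "n * k \<le> (k + 1) * (n - k)"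
  shows "card (Domain H) = n - k \<and> card (Range H) = k \<and> H = Domain H \<times> Range H"
proof -
  have finI: "finite (H `` {x})" "finite (H\<inverse> `` {y})" for x y
    using fin by (auto intro: finite_Image)
  have finR: "finite (Range H)" "finite (Domain H)"
    using fin by (auto simp: finite_Range finite_Domain)
  have degx: "card (H `` {x}) = k" if x: "x \<in> Domain H" for x
  proof -
    let ?b = "card (H `` {x})"
    obtain y where "(x, y) \<in> H" using x by auto
    then have "k \<le> ?b" using heavy[of x y] right[of y] left[of x] by linarith
    moreover have "?b * (n - ?b) \<le> (\<Sum>y\<in>H `` {x}. card (H\<inverse> `` {y}))"
      using heavy[of x] by (intro sum_bounded_below[of _ "n - ?b" for n, simplified of_nat_id]) force
    then have "?b * (n - ?b) < n * k"
      using card_rel_ge_sum_Image[of "H\<inverse>" "H `` {x}"] fin finI few by simp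
    then have "\<not> (k < ?b \<and> ?b < n - k)" using conc[of ?b] by auto
    ultimately show ?thesis using left[of x] by linarith
  qed
  have degy: "card (H\<inverse> `` {y}) = n - k" if y: "y \<in> Range H" for y
  proof -
    obtain x where "(x, y) \<in> H" using y by auto
    then show ?thesis using heavy[of x y] degx[of x] right[of y] kn by fastforce
  qed
  have "card H = (\<Sum>y\<in>Range H. card (H\<inverse> `` {y}))"
    using card_rel_eq_sum_Image[of "H\<inverse>"] fin by simp
  also have "\<dots> = card (Range H) * (n - k)" using degy by simp
  finally have cH: "card H = card (Range H) * (n - k)" .
  \<comment> \<open>Already \<open>k + 1\<close> vertices of degree \<open>n - k\<close> would
    contribute \<open>n * k\<close> edges, by \<open>wide\<close>.\<close>
  have "card (Range H) \<le> k"
  proof (rule ccontr)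
    assume "\<not> ?thesis"
    then have "(k + 1) * (n - k) \<le> card (Range H) * (n - k)"
      by (intro mult_le_mono1) simp
    then show False using cH few wide by linarith
  qed
  then have img: "H `` {x} = Range H" if "x \<in> Domain H" for x
    using degx[OF that] finR by (intro card_seteq) auto
  have prod: "H = Domain H \<times> Range H"
  proof (intro equalityI subsetI)
    fix e assume "e \<in> Domain H \<times> Range H"
    then obtain x y where "e = (x, y)" "x \<in> Domain H" "y \<in> H `` {x}" using img by (cases e) auto
    then show "e \<in> H" by simp
  qed auto
  obtain x y where xy: "x \<in> Domain H" "y \<in> Range H" using ne by auto
  have "H\<inverse> `` {y} = Domain H" using xy(2) by (subst prod) auto
  then show ?thesis using prod img[OF xy(1)] degx[OF xy(1)] degy[OF xy(2)] by metis
qed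

text \<open>The bipartite complement of a maximal supergraph is a complete bipartite block. The
  hypotheses \<open>conc\<close> and \<open>wide\<close> isolate the arithmetic in \<open>n\<close>
  and \<open>k\<close>, so that one argument serves both \<open>(k + 1)^2 \<le> n\<close> and the
  case \<open>k = 1\<close>, \<open>n = 3\<close>.\<close>

lemma nontraceable_misses_product:
  fixes X Y :: "'a set"
  assumes fin: "finite X" "finite Y" and disj: "X \<inter> Y = {}"
    and cX: "card X = n" and cY: "card Y + 1 = n"
    and E: "E \<subseteq> X \<times> Y"
    and nopath: "\<nexists>p. hamiltonian_path (sym_edges E) (X \<union> Y) p"
    and kn: "k < n" and many: "n * (n - k - 1) < card E"
    and degX: "\<And>x. x \<in> X \<Longrightarrow> k \<le> card (E `` {x})"
    and degY: "\<And>y. y \<in> Y \<Longrightarrow> k \<le> card (E\<inverse> `` {y})"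
    and conc: "\<And>b. k < b \<Longrightarrow> b < n - k \<Longrightarrow> n * k \<le> b * (n - b)"
    and wide: "n * k \<le> (k + 1) * (n - k)"
  obtains A B where "A \<subseteq> X" "B \<subseteq> Y" "card A = n - k" "card B = k" "E \<inter> A \<times> B = {}"
proof -
  obtain F where F: "E \<subseteq> F" "F \<subset> X \<times> Y"
    and light: "\<And>x y. x \<in> X \<Longrightarrow> y \<in> Y \<Longrightarrow> (x, y) \<notin> F \<Longrightarrow> card (F `` {x}) + card (F\<inverse> `` {y}) < n"
    using maximal_nontraceable_supergraph[OF fin disj _ E nopath] cX cY by metis
  define H where "H = X \<times> Y - F"
  have HXY: "H \<subseteq> X \<times> Y" by (auto simp: H_def)
  have finH: "finite H" using fin by (simp add: H_def)
  have finF: "finite F" using fin F(2) by (meson finite_SigmaI finite_subset psubset_imp_subset)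
  have dx: "card (H `` {x}) + card (F `` {x}) = n - 1" if "x \<in> X" for x
  proof -
    have "H `` {x} \<union> F `` {x} = Y" "H `` {x} \<inter> F `` {x} = {}"
      using that F(2) by (auto simp: H_def)
    then show ?thesis using cY finH finF card_Un_disjoint[of "H `` {x}" "F `` {x}"]
      by (simp add: finite_Image)
  qed
  have dy: "card (H\<inverse> `` {y}) + card (F\<inverse> `` {y}) = n" if "y \<in> Y" for y
  proof -
    have "H\<inverse> `` {y} \<union> F\<inverse> `` {y} = X" "H\<inverse> `` {y} \<inter> F\<inverse> `` {y} = {}"
      using that F(2) by (auto simp: H_def)
    then show ?thesis using cX finH finF card_Un_disjoint[of "H\<inverse> `` {y}" "F\<inverse> `` {y}"]
      by (simp add: finite_Image)
  qed
  have kF: "k \<le> card (F `` {x})" if "x \<in> X" for x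
  proof -
    have "card (E `` {x}) \<le> card (F `` {x})"
      using F(1) finF by (intro card_mono finite_Image) auto
    then show ?thesis using degX[OF that] by linarith
  qed
  have kF': "k \<le> card (F\<inverse> `` {y})" if "y \<in> Y" for y
  proof -
    have "card (E\<inverse> `` {y}) \<le> card (F\<inverse> `` {y})"
      using F(1) finF by (intro card_mono finite_Image) auto
    then show ?thesis using degY[OF that] by linarith
  qed
  have "card (Domain H) = n - k \<and> card (Range H) = k \<and> H = Domain H \<times> Range H"
  proof (rule product_of_heavy_edges[OF finH _ less_imp_le[OF kn]])
    show "H \<noteq> {}" using F(2) by (auto simp: H_def)
  next
    \<comment> \<open>The parts have sizes \<open>n\<close> and \<open>n - 1\<close>, so the two
      degrees in \<open>H\<close> add up to \<open>2 * n - 1\<close> minus a degree sum in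
      \<open>F\<close> below \<open>n\<close>.\<close>
    fix x y assume xy: "(x, y) \<in> H"
    then have "x \<in> X" "y \<in> Y" "(x, y) \<notin> F" by (auto simp: H_def)
    then show "n \<le> card (H `` {x}) + card (H\<inverse> `` {y})"
      using dx[of x] dy[of y] light[of x y] by linarith
  next
    fix x
    \<comment> \<open>Strict on this side only: a vertex of \<open>X\<close> has just
      \<open>n - 1\<close> possible neighbours.\<close>
    show "card (H `` {x}) < n - k"
    proof (cases "x \<in> X")
      case True
      then show ?thesis using dx[of x] kF[of x] kn by linarith
    next
      case False
      then have "H `` {x} = {}" using HXY by auto
      then show ?thesis using kn by simp
    qed
  next
    fix y
    show "card (H\<inverse> `` {y}) \<le> n - k"
    proof (cases "y \<in> Y")
      case True
      then show ?thesis using dy[of y] kF'[of y] by linarith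
    next
      case False
      then have "H\<inverse> `` {y} = {}" using HXY by auto
      then show ?thesis by simp
    qed
  next
    have "card H + card F = card (X \<times> Y)"
      using fin F(2) card_mono[of "X \<times> Y" F]
      by (simp add: H_def card_Diff_subset finF psubset_imp_subset)
    also have "\<dots> = n * (n - k - 1) + n * k"
    proof -
      have "card Y = (n - k - 1) + k" using cY kn by linarith
      then show ?thesis using cX by (simp add: card_cartesian_product distrib_left)
    qed
    finally show "card H < n * k"
      using many card_mono[OF finF F(1)] by linarith
  qed (use conc wide in auto)
  moreover have "Domain H \<subseteq> X" "Range H \<subseteq> Y" using HXY by auto
  moreover have "E \<inter> H = {}" using F(1) by (auto simp: H_def)
  ultimately show ?thesis using that by metis
qed

section \<open>Bounds on signless Laplacian eigenvalues\<close>

text \<open>The operator D + A of the graph with arc set \<open>R\<close>, acting on functions of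
  vertices and thus free of the vertex enumeration behind the matrix.\<close>

definition signless_apply :: "'a rel \<Rightarrow> ('a \<Rightarrow> real) \<Rightarrow> 'a \<Rightarrow> real" where
  "signless_apply R f v = real (card (R `` {v})) * f v + (\<Sum>u\<in>R `` {v}. f u)"

lemma parcs_graph_of: "parcs (graph_of B) = sym_edges (bedges B)"
  by (simp add: graph_of_def sym_edges_def)

lemma pverts_graph_of: "pverts (graph_of B) = left B \<union> right B"
  by (simp add: graph_of_def)

lemma vdegree_graph_of: "vdegree (graph_of B) v = card (sym_edges (bedges B) `` {v})"
proof -
  have "out_arcs (with_proj (graph_of B)) v = Pair v ` (sym_edges (bedges B) `` {v})"
    by (auto simp: out_arcs_def parcs_graph_of)
  then show ?thesis by (simp add: out_degree_def card_image inj_on_def)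
qed

lemma sym_edges_Image_left:
  "E \<subseteq> X \<times> Y \<Longrightarrow> X \<inter> Y = {} \<Longrightarrow> x \<in> X \<Longrightarrow> sym_edges E `` {x} = E `` {x}"
  by (auto simp: sym_edges_def)

lemma sym_edges_Image_right:
  "E \<subseteq> X \<times> Y \<Longrightarrow> X \<inter> Y = {} \<Longrightarrow> y \<in> Y \<Longrightarrow> sym_edges E `` {y} = E\<inverse> `` {y}"
  by (auto simp: sym_edges_def)

lemma eigenvalue_graph_of_iff:
  assumes "bipartite_graph B"
  shows "eigenvalue (signless_laplacian (vertex_list (graph_of B)) (graph_of B)) x \<longleftrightarrow>
    (\<exists>g. (\<exists>v\<in>left B \<union> right B. g v \<noteq> 0) \<and>
      (\<forall>v\<in>left B \<union> right B. signless_apply (sym_edges (bedges B)) g v = x * g v))"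
proof -
  have "finite (pverts (graph_of B))"
    using assms by (simp add: bipartite_graph_def pverts_graph_of)
  note vl = vertex_list[OF this]
  have "{u \<in> left B \<union> right B. (v, u) \<in> sym_edges (bedges B)} = sym_edges (bedges B) `` {v}" for v
    using assms by (auto simp: bipartite_graph_def sym_edges_def)
  then show ?thesis
    unfolding eigenvalue_signless_laplacian_iff[OF vl(1)] vl(2)
    by (simp add: signless_apply_def parcs_graph_of pverts_graph_of vdegree_graph_of)
qed

lemma q_radius_props:
  assumes B: "bipartite_graph B" and ne: "left B \<union> right B \<noteq> {}"
  shows q_radius_eigenvalue: "\<exists>g. (\<exists>v\<in>left B \<union> right B. g v \<noteq> 0) \<and>
      (\<forall>v\<in>left B \<union> right B. signless_apply (sym_edges (bedges B)) g v = q_radius (graph_of B) * g v)"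
    and q_radius_ge: "\<And>x g. \<exists>v\<in>left B \<union> right B. g v \<noteq> 0 \<Longrightarrow>
      \<forall>v\<in>left B \<union> right B. signless_apply (sym_edges (bedges B)) g v = x * g v \<Longrightarrow> x \<le> q_radius (graph_of B)"
proof -
  let ?A = "signless_laplacian (vertex_list (graph_of B)) (graph_of B)"
  let ?E = "bedges B" and ?X = "left B" and ?Y = "right B"
  have "?A \<in> carrier_mat (length (vertex_list (graph_of B))) (length (vertex_list (graph_of B)))"
    by (simp add: signless_laplacian_def degree_mat_def adjacency_mat_def)
  then have fin: "finite (spectrum ?A)" by (rule card_finite_spectrum)
  have disj: "?X \<inter> ?Y = {}" and E: "?E \<subseteq> ?X \<times> ?Y"
    using B by (auto simp: bipartite_graph_def)
  \<comment> \<open>The sign function of the bipartition lies in the kernel of D + A. Hence 0 is an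
    eigenvalue, the spectrum is nonempty and its \<open>Max\<close> is attained.\<close>
  define s :: "'a \<Rightarrow> real" where "s v = (if v \<in> ?X then 1 else - 1)" for v
  have "signless_apply (sym_edges ?E) s v = 0" if v: "v \<in> ?X \<union> ?Y" for v
  proof (cases "v \<in> ?X")
    case True
    then have "s u = - 1" if "u \<in> sym_edges ?E `` {v}" for u
      using that E disj by (auto simp: s_def sym_edges_def)
    then show ?thesis using True by (simp add: signless_apply_def s_def)
  next
    case False
    then have "s u = 1" if "u \<in> sym_edges ?E `` {v}" for u
      using that E disj by (auto simp: s_def sym_edges_def)
    then show ?thesis using False by (simp add: signless_apply_def s_def)
  qed
  moreover have "\<exists>v\<in>?X \<union> ?Y. s v \<noteq> 0" using ne by (auto simp: s_def)
  ultimately have "eigenvalue ?A 0"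
    unfolding eigenvalue_graph_of_iff[OF B] by (intro exI[of _ s]) simp
  then have "spectrum ?A \<noteq> {}" by (auto simp: spectrum_def)
  then have "q_radius (graph_of B) \<in> spectrum ?A"
    unfolding q_radius_def using fin by simp
  then have "eigenvalue ?A (q_radius (graph_of B))" by (simp add: spectrum_def)
  then show "\<exists>g. (\<exists>v\<in>?X \<union> ?Y. g v \<noteq> 0) \<and>
      (\<forall>v\<in>?X \<union> ?Y. signless_apply (sym_edges ?E) g v = q_radius (graph_of B) * g v)"
    unfolding eigenvalue_graph_of_iff[OF B] .
  fix x g
  assume "\<exists>v\<in>?X \<union> ?Y. g v \<noteq> 0" "\<forall>v\<in>?X \<union> ?Y. signless_apply (sym_edges ?E) g v = x * g v"
  then have "eigenvalue ?A x" unfolding eigenvalue_graph_of_iff[OF B] by blast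
  then show "x \<le> q_radius (graph_of B)"
    unfolding q_radius_def using fin by (simp add: spectrum_def)
qed

section \<open>Comparison with positive test functions\<close>

text \<open>D + A has nonnegative entries, so a domination at \<open>v\<close> and its neighbours
  passes to the images.\<close>

lemma abs_signless_apply_le:
  assumes "finite (R `` {v})" "\<bar>g v\<bar> \<le> t * f v" "\<And>u. (v, u) \<in> R \<Longrightarrow> \<bar>g u\<bar> \<le> t * f u"
  shows "\<bar>signless_apply R g v\<bar> \<le> t * signless_apply R f v"
proof -
  have "\<bar>signless_apply R g v\<bar> \<le> real (card (R `` {v})) * \<bar>g v\<bar> + (\<Sum>u\<in>R `` {v}. \<bar>g u\<bar>)"
    unfolding signless_apply_def by (intro abs_triangle_ineq[THEN order_trans] add_mono sum_abs) (simp add: abs_mult)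
  also have "\<dots> \<le> real (card (R `` {v})) * (t * f v) + (\<Sum>u\<in>R `` {v}. t * f u)"
    using assms by (intro add_mono mult_left_mono sum_mono) auto
  also have "\<dots> = t * signless_apply R f v"
    by (simp add: signless_apply_def sum_distrib_left algebra_simps)
  finally show ?thesis .
qed

text \<open>Collatz-Wielandt bound: evaluate the eigenvalue equation where the ratio of
  \<open>\<bar>g\<bar>\<close> to \<open>f\<close> is largest. Conditions on \<open>f\<close> are
  imposed at non-isolated vertices only, so that \<open>f\<close> may be the degree
  function.\<close>

lemma eigenvalue_le_of_test_function:
  assumes fin: "finite V" and R: "R \<subseteq> V \<times> V" and sym: "sym R" and c: "0 \<le> c"
    and pos: "\<And>v. v \<in> V \<Longrightarrow> R `` {v} \<noteq> {} \<Longrightarrow> 0 < f v"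
    and sub: "\<And>v. v \<in> V \<Longrightarrow> R `` {v} \<noteq> {} \<Longrightarrow> signless_apply R f v \<le> c * f v"
    and ne: "\<exists>v\<in>V. g v \<noteq> 0"
    and eig: "\<forall>v\<in>V. signless_apply R g v = l * g v"
  shows "l \<le> c"
proof (rule ccontr)
  assume "\<not> l \<le> c"
  then have l: "c < l" "0 < l" using c by auto
  define W where "W = {v \<in> V. R `` {v} \<noteq> {}}"
  \<comment> \<open>At an isolated vertex the equation reads \<open>0 = l * g v\<close>, and
    \<open>l\<close> is positive.\<close>
  have zero: "g v = 0" if "v \<in> V - W" for v
  proof -
    have "signless_apply R g v = 0" using that by (auto simp: W_def signless_apply_def)
    then show ?thesis using eig that l by auto
  qed
  have finW: "finite W" using fin by (simp add: W_def)
  obtain w where w: "w \<in> W" "g w \<noteq> 0" using ne zero by blast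
  define t where "t = Max ((\<lambda>v. \<bar>g v\<bar> / f v) ` W)"
  have fW: "0 < f v" if "v \<in> W" for v using pos that by (auto simp: W_def)
  have le: "\<bar>g v\<bar> \<le> t * f v" if "v \<in> W" for v
  proof -
    have "\<bar>g v\<bar> / f v \<le> t" unfolding t_def using finW that by (intro Max_ge) auto
    then show ?thesis using fW[OF that] by (simp add: field_simps)
  qed
  have "0 < t * f w" using le[OF w(1)] w(2) by linarith
  then have t: "0 < t" using fW[OF w(1)] by (simp add: zero_less_mult_iff)
  have "t \<in> (\<lambda>v. \<bar>g v\<bar> / f v) ` W" unfolding t_def using finW w by (intro Max_in) auto
  then obtain v where v: "v \<in> W" "t = \<bar>g v\<bar> / f v" by blast
  have gv: "\<bar>g v\<bar> = t * f v" using v fW[OF v(1)] by simp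
  have nb: "u \<in> W" if "(v, u) \<in> R" for u
    using that R sym by (auto simp: W_def dest: symD)
  have "\<bar>signless_apply R g v\<bar> \<le> t * signless_apply R f v"
    using gv le nb fin R by (intro abs_signless_apply_le) (auto intro: finite_subset[OF _ fin])
  moreover have "\<bar>signless_apply R g v\<bar> = l * \<bar>g v\<bar>"
    using eig v l by (simp add: W_def abs_mult)
  moreover have "t * signless_apply R f v \<le> t * (c * f v)"
    using sub[of v] v(1) t by (intro mult_left_mono) (simp_all add: W_def)
  ultimately have "l * \<bar>g v\<bar> \<le> c * \<bar>g v\<bar>" using gv by (simp add: algebra_simps)
  moreover have "0 < \<bar>g v\<bar>" using gv t fW[OF v(1)] by simp
  ultimately show False using l by simp
qed

text \<open>At a vertex where \<open>\<bar>g\<bar> / f\<close> is maximal, all inequalities must be equalities,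
  so the neighbourhoods agree and the maximum is attained at all neighbours too.\<close>

lemma subgraph_eq_if_eigenvalue_ge:
  assumes fin: "finite V" and RR: "R \<subseteq> R'" and R': "R' \<subseteq> V \<times> V"
    and conn: "\<And>T. T \<subseteq> V \<Longrightarrow> T \<noteq> {} \<Longrightarrow> R' `` T \<subseteq> T \<Longrightarrow> T = V"
    and pos: "\<And>v. v \<in> V \<Longrightarrow> 0 < f v"
    and eig': "\<And>v. v \<in> V \<Longrightarrow> signless_apply R' f v = q * f v"
    and ne: "\<exists>v\<in>V. g v \<noteq> 0"
    and eig: "\<forall>v\<in>V. signless_apply R g v = l * g v"
    and ql: "q \<le> l"
  shows "R = R'"
proof -
  define t where "t = Max ((\<lambda>v. \<bar>g v\<bar> / f v) ` V)"
  obtain w where w: "w \<in> V" "g w \<noteq> 0" using ne by blast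
  have le: "\<bar>g v\<bar> \<le> t * f v" if "v \<in> V" for v
  proof -
    have "\<bar>g v\<bar> / f v \<le> t" unfolding t_def using fin that by (intro Max_ge) auto
    then show ?thesis using pos[OF that] by (simp add: field_simps)
  qed
  have "0 < t * f w" using le[OF w(1)] w(2) by linarith
  then have t: "0 < t" using pos[OF w(1)] by (simp add: zero_less_mult_iff)
  define T where "T = {v \<in> V. \<bar>g v\<bar> = t * f v}"
  have "t \<in> (\<lambda>v. \<bar>g v\<bar> / f v) ` V" unfolding t_def using fin w by (intro Max_in) auto
  then obtain v0 where "v0 \<in> V" "t = \<bar>g v0\<bar> / f v0" by blast
  then have "v0 \<in> T" using pos[of v0] by (simp add: T_def)
  have step: "R `` {v} = R' `` {v} \<and> R' `` {v} \<subseteq> T" if "v \<in> T" for v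
  proof -
    have v: "v \<in> V" "\<bar>g v\<bar> = t * f v" using that by (auto simp: T_def)
    let ?D = "R `` {v}" and ?D' = "R' `` {v}"
    have finD: "finite ?D'" "finite ?D"
      using R' RR by (auto intro: finite_subset[OF _ fin])
    have DD: "?D \<subseteq> ?D'" "?D' \<subseteq> V" using RR R' by auto
    have "q * (t * f v) \<le> l * (t * f v)"
      using ql t pos[OF v(1)] by (simp add: mult_right_mono)
    also have "\<dots> \<le> \<bar>signless_apply R g v\<bar>"
      using eig v by (metis abs_ge_self abs_mult abs_abs mult_right_mono abs_ge_zero)
    also have "\<dots> \<le> real (card ?D) * (t * f v) + (\<Sum>u\<in>?D. \<bar>g u\<bar>)"
      unfolding signless_apply_def v(2)[symmetric]
      by (intro abs_triangle_ineq[THEN order_trans] add_mono sum_abs) (simp add: abs_mult)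
    \<comment> \<open>Here \<open>q * f v\<close> has been expanded by the eigenvalue equation of
      \<open>f\<close> for \<open>R'\<close>.\<close>
    finally have key: "real (card ?D') * (t * f v) + t * (\<Sum>u\<in>?D'. f u)
        \<le> real (card ?D) * (t * f v) + (\<Sum>u\<in>?D. \<bar>g u\<bar>)"
      using eig'[OF v(1)] unfolding signless_apply_def
      by (smt (verit, best) distrib_left mult.assoc mult.left_commute)
    have "(\<Sum>u\<in>?D. \<bar>g u\<bar>) \<le> (\<Sum>u\<in>?D. t * f u)"
      using le DD by (intro sum_mono) auto
    also have "\<dots> \<le> (\<Sum>u\<in>?D'. t * f u)"
      using finD DD t pos by (intro sum_mono2) (auto intro!: mult_nonneg_nonneg less_imp_le)
    finally have "(\<Sum>u\<in>?D. \<bar>g u\<bar>) \<le> t * (\<Sum>u\<in>?D'. f u)" by (simp add: sum_distrib_left)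
    with key have "real (card ?D') * (t * f v) \<le> real (card ?D) * (t * f v)" by linarith
    then have "card ?D' \<le> card ?D" using t pos[OF v(1)] by simp
    then have eq: "?D = ?D'" using DD finD by (intro card_seteq) auto
    \<comment> \<open>With equal neighbourhoods the degree terms cancel, and a sum of nonnegative
      terms is at most 0, so each term vanishes.\<close>
    with key have "(\<Sum>u\<in>?D'. t * f u - \<bar>g u\<bar>) \<le> 0"
      by (simp add: sum_subtractf sum_distrib_left)
    moreover have nn: "\<And>u. u \<in> ?D' \<Longrightarrow> 0 \<le> t * f u - \<bar>g u\<bar>" using le DD by auto
    ultimately have "(\<Sum>u\<in>?D'. t * f u - \<bar>g u\<bar>) = 0"
      by (meson antisym sum_nonneg)
    then have "\<forall>u\<in>?D'. t * f u - \<bar>g u\<bar> = 0"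
      using sum_nonneg_eq_0_iff[of ?D' "\<lambda>u. t * f u - \<bar>g u\<bar>"] finD(1) nn by simp
    then show ?thesis using eq DD by (auto simp: T_def)
  qed
  have "T = V"
  proof (rule conn)
    show "T \<subseteq> V" by (auto simp: T_def)
    show "T \<noteq> {}" using \<open>v0 \<in> T\<close> by auto
    show "R' `` T \<subseteq> T" using step by blast
  qed
  then show ?thesis using step RR R' by blast
qed

section \<open>Upper bounds from the degree function\<close>

text \<open>With \<open>f\<close> the degree, D + A maps \<open>f\<close> at \<open>v\<close> to
  \<open>d^2 + S\<close>, where \<open>S\<close> is the sum of the degrees of the neighbours of
  \<open>v\<close>. Two estimates of \<open>S\<close> are combined, \<open>S \<le> card E\<close>
  and \<open>S \<le> d * n\<close>.\<close>

lemma eigenvalue_le_edge_bound: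
  fixes X Y :: "'a set"
  assumes fin: "finite X" "finite Y" and disj: "X \<inter> Y = {}" and E: "E \<subseteq> X \<times> Y"
    and n: "card X \<le> n" "card Y \<le> n" "0 < n"
    and ne: "\<exists>v\<in>X \<union> Y. g v \<noteq> 0"
    and eig: "\<forall>v\<in>X \<union> Y. signless_apply (sym_edges E) g v = l * g v"
  shows "l \<le> real n + real (card E) / real n"
proof (rule eigenvalue_le_of_test_function[OF _ _ _ _ _ _ ne eig])
  let ?R = "sym_edges E"
  let ?f = "\<lambda>v. real (card (?R `` {v}))"
  have finE: "finite E" using fin E by (meson finite_SigmaI finite_subset)
  show "finite (X \<union> Y)" "?R \<subseteq> (X \<union> Y) \<times> (X \<union> Y)" "sym ?R" "0 \<le> real n + real (card E) / real n"
    using fin E by (auto simp: sym_edges_def sym_def)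
  fix v assume v: "v \<in> X \<union> Y" and nz: "?R `` {v} \<noteq> {}"
  have finR: "finite (?R `` {v})" for v
    using finE by (auto simp: sym_edges_def intro: finite_Image)
  show "0 < ?f v" using nz finR[of v] by (simp add: card_gt_0_iff)
  define d where "d = card (?R `` {v})"
  define S where "S = (\<Sum>u\<in>?R `` {v}. card (?R `` {u}))"
  have "card (?R `` {u}) \<le> n" if "u \<in> X \<union> Y" for u
  proof -
    have "?R `` {u} \<subseteq> X \<or> ?R `` {u} \<subseteq> Y"
      using that E disj by (auto simp: sym_edges_def)
    then show ?thesis using fin n card_mono le_trans by metis
  qed
  moreover have "?R `` {v} \<subseteq> X \<union> Y" using E by (auto simp: sym_edges_def)
  ultimately have d: "d \<le> n" and Sd: "S \<le> d * n"
    using v sum_bounded_above[of "?R `` {v}" "\<lambda>u. card (?R `` {u})" n]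
    by (auto simp: d_def S_def)
  \<comment> \<open>The neighbours of \<open>v\<close> lie in one part, so the edges at different
    neighbours are distinct.\<close>
  have Se: "S \<le> card E"
  proof (cases "v \<in> X")
    case True
    then have "?R `` {v} \<subseteq> Y" using E disj by (auto simp: sym_edges_def)
    then have "S = (\<Sum>u\<in>?R `` {v}. card (E\<inverse> `` {u}))"
      unfolding S_def using sym_edges_Image_right[OF E disj] by (intro sum.cong) auto
    also have "\<dots> \<le> card (E\<inverse>)"
      using finE finR by (intro card_rel_ge_sum_Image) auto
    finally show ?thesis by simp
  next
    case False
    then have "?R `` {v} \<subseteq> X" using E by (auto simp: sym_edges_def)
    then have "S = (\<Sum>u\<in>?R `` {v}. card (E `` {u}))"
      unfolding S_def using sym_edges_Image_left[OF E disj] by (intro sum.cong) auto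
    also have "\<dots> \<le> card E"
      using finE finR by (intro card_rel_ge_sum_Image) auto
    finally show ?thesis .
  qed
  \<comment> \<open>Weighted average: \<open>S\<close> is at most \<open>d / n\<close> times
    \<open>card E\<close> plus \<open>1 - d / n\<close> times \<open>d * n\<close>.\<close>
  have "real n * real S - real d * real (card E) \<le> (real n - real d) * real S"
    using mult_left_mono[of "real S" "real (card E)" "real d"] Se by (simp add: algebra_simps)
  also have "\<dots> \<le> (real n - real d) * (real d * real n)"
    using d Sd by (intro mult_left_mono) (simp_all flip: of_nat_mult)
  finally have "real d * real d + real S \<le> (real n + real (card E) / real n) * real d"
    using n(3) by (simp add: field_simps)
  then show "signless_apply ?R ?f v \<le> (real n + real (card E) / real n) * ?f v"
    by (simp add: signless_apply_def d_def S_def)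
qed

text \<open>\<open>V\<close> may contain further vertices, necessarily isolated. Removing an
  isolated vertex from its part therefore lowers the bound by one.\<close>

lemma eigenvalue_le_order_bound:
  fixes X Y :: "'a set"
  assumes finV: "finite V" and V: "X \<subseteq> V" "Y \<subseteq> V"
    and disj: "X \<inter> Y = {}" and E: "E \<subseteq> X \<times> Y"
    and ne: "\<exists>v\<in>V. g v \<noteq> 0"
    and eig: "\<forall>v\<in>V. signless_apply (sym_edges E) g v = l * g v"
  shows "l \<le> real (card X + card Y)"
proof (rule eigenvalue_le_of_test_function[OF finV _ _ _ _ _ ne eig])
  let ?R = "sym_edges E"
  let ?f = "\<lambda>v. real (card (?R `` {v}))"
  have fin: "finite X" "finite Y" using V finV finite_subset by auto
  have finE: "finite E" using fin E by (meson finite_SigmaI finite_subset)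
  show "?R \<subseteq> V \<times> V" "sym ?R" "0 \<le> real (card X + card Y)"
    using V E by (auto simp: sym_edges_def sym_def)
  fix v assume v: "v \<in> V" and nz: "?R `` {v} \<noteq> {}"
  have finR: "finite (?R `` {v})" for v
    using finE by (auto simp: sym_edges_def intro: finite_Image)
  show "0 < ?f v" using nz finR[of v] by (simp add: card_gt_0_iff)
  \<comment> \<open>\<open>P\<close> is the part opposite to \<open>v\<close> and bounds its degree;
    \<open>Q\<close> bounds the degrees of the vertices in \<open>P\<close>.\<close>
  obtain P Q where PQ: "?R `` {v} \<subseteq> P" "\<And>u. u \<in> P \<Longrightarrow> ?R `` {u} \<subseteq> Q" "finite P" "finite Q"
    "card P + card Q = card X + card Y"
  proof (cases "v \<in> X")
    case True
    show ?thesis by (rule that[of Y X]) (use True fin E disj in \<open>auto simp: sym_edges_def\<close>)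
  next
    case False
    show ?thesis by (rule that[of X Y]) (use False fin E disj in \<open>auto simp: sym_edges_def\<close>)
  qed
  have "(\<Sum>u\<in>?R `` {v}. ?f u) \<le> real (card (?R `` {v})) * real (card Q)"
    using PQ by (intro sum_bounded_above) (auto intro: card_mono)
  moreover have "real (card (?R `` {v})) * ?f v \<le> real (card (?R `` {v})) * real (card P)"
    using PQ by (intro mult_left_mono) (auto intro: card_mono)
  ultimately have "signless_apply ?R ?f v \<le> ?f v * (real (card P) + real (card Q))"
    unfolding signless_apply_def by (simp add: algebra_simps)
  then show "signless_apply ?R ?f v \<le> real (card X + card Y) * ?f v"
    using PQ(5) by (simp flip: of_nat_add add: mult.commute)
qed

section \<open>The extremal graphs\<close>

text \<open>The signless Laplacian of \<open>S\<^sub>n\<^sup>k\<close> on vectors that are constant on the four vertex classes;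
  eliminating \<open>a\<close>, \<open>b\<close>, \<open>c\<close>, \<open>e\<close> leaves the quartic equation \<open>P q = 0\<close> below.\<close>

lemma ex_positive_quotient_eigenvector:
  fixes n k :: real
  assumes k: "1 \<le> k" and n: "2 * k + 1 \<le> n"
  obtains q a b c e :: real where "2 * n - k - 1 < q" "0 < a" "0 < b" "0 < c" "0 < e"
    "(n - 1) * a + (n - k - 1) * c + k * e = q * a"
    "(n - k - 1) * b + (n - k - 1) * c = q * b"
    "n * c + k * a + (n - k) * b = q * c"
    "k * e + k * a = q * e"
proof -
  define m where "m = n - k - 1"
  define P where "P q = ((q - n + 1) * (q - k) - k * k) * ((q - n) * (q - m) - (n - k) * m)
    - k * m * ((q - k) * (q - m))" for q
  let ?s = "n + m"
  have m: "0 < m" "k \<le> m" "m < n" using k n by (auto simp: m_def)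
  \<comment> \<open>At \<open>q = n + m\<close>, the desired lower bound
    \<open>2 * n - k - 1\<close>, the factor \<open>(q - n) * (q - m) - (n - k) * m\<close> equals
    \<open>k * m\<close>, which can be pulled out.\<close>
  have Ps: "P ?s = k * m * (- k * (?s - k) - k * k)"
    unfolding P_def m_def by (simp add: algebra_simps)
  have "0 < k * (?s - k)" "0 \<le> k * k" using k m n by simp_all
  then have "- k * (?s - k) - k * k < 0" by linarith
  then have "P ?s < 0"
    unfolding Ps using k m by (intro mult_pos_neg) simp_all
  \<comment> \<open>At \<open>4 * n\<close> the leading product is at least \<open>64 * n^4\<close>,
    while the subtracted term is at most \<open>16 * n^4\<close>.\<close>
  moreover have "0 \<le> P (4 * n)"
  proof -
    have "3 * n * (3 * n) - n * n \<le> (4 * n - n + 1) * (4 * n - k) - k * k"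
      using k n by (intro diff_mono mult_mono) auto
    moreover have "3 * n * (3 * n) - n * n \<le> (4 * n - n) * (4 * n - m) - (n - k) * m"
      using k n m by (intro diff_mono mult_mono) auto
    moreover have "0 \<le> n * n" by simp
    ultimately have "(8 * (n * n)) * (8 * (n * n)) \<le>
      ((4 * n - n + 1) * (4 * n - k) - k * k) * ((4 * n - n) * (4 * n - m) - (n - k) * m)"
      by (intro mult_mono) linarith+
    moreover have "k * m * ((4 * n - k) * (4 * n - m)) \<le> (n * n) * ((4 * n) * (4 * n))"
      using k n m by (intro mult_mono) auto
    moreover have "(n * n) * ((4 * n) * (4 * n)) \<le> (8 * (n * n)) * (8 * (n * n))"
      using k n by simp
    ultimately show ?thesis unfolding P_def by linarith
  qed
  moreover have "continuous_on {?s..4 * n} P" unfolding P_def by (intro continuous_intros)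
  moreover have "?s \<le> 4 * n" using k n by (simp add: m_def)
  ultimately obtain q where q: "?s \<le> q" "P q = 0"
    using IVT'[of P ?s 0 "4 * n"] by auto
  with \<open>P ?s < 0\<close> have sq: "?s < q" by (cases "q = ?s") auto
  define a where "a = (q - n) * (q - m) - (n - k) * m"
  have "(n - k) * m < n * m" using k m by simp
  also have "\<dots> \<le> (q - m) * (q - n)" using sq m by (intro mult_mono) auto
  finally have a: "0 < a" by (simp add: a_def mult.commute)
  have qk: "0 < q - k" "0 < q - m" using sq m k n by auto
  show ?thesis
  \<comment> \<open>The second equation fixes the ratio of \<open>b\<close> to \<open>c\<close> as
    \<open>m\<close> to \<open>q - m\<close>, scaled here by \<open>k\<close>. The third then gives
    \<open>a\<close>, the fourth gives \<open>e\<close>, and the first becomes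
    \<open>P q = 0\<close>.\<close>
  proof (rule that[of q a "k * m" "k * (q - m)" "k * a / (q - k)"])
    show "2 * n - k - 1 < q" using sq by (simp add: m_def)
    show "0 < a" "0 < k * m" "0 < k * (q - m)" "0 < k * a / (q - k)"
      using a k m qk by simp_all
    have "((q - n + 1) * (q - k) - k * k) * a = k * m * ((q - k) * (q - m))"
      using q(2) by (simp add: P_def a_def)
    then have "(q - k) * ((n - 1) * a + m * (k * (q - m))) + k * (k * a) = (q - k) * (q * a)"
      by (simp add: algebra_simps)
    moreover have "(q - k) * ((n - 1) * a + m * (k * (q - m)) + k * (k * a / (q - k))) =
        (q - k) * ((n - 1) * a + m * (k * (q - m))) + k * (k * a)"
      using qk by (simp add: distrib_left)
    ultimately have "(q - k) * ((n - 1) * a + m * (k * (q - m)) + k * (k * a / (q - k))) =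
        (q - k) * (q * a)" by simp
    then show "(n - 1) * a + (n - k - 1) * (k * (q - m)) + k * (k * a / (q - k)) = q * a"
      using qk by (simp add: m_def)
    show "(n - k - 1) * (k * m) + (n - k - 1) * (k * (q - m)) = q * (k * m)"
      unfolding m_def[symmetric] by (simp add: algebra_simps)
    show "n * (k * (q - m)) + k * a + (n - k) * (k * m) = q * (k * (q - m))"
      by (simp add: a_def algebra_simps)
    show "k * (k * a / (q - k)) + k * a = q * (k * a / (q - k))"
      using qk by (simp add: field_simps)
  qed
qed

section \<open>Complete bipartite graphs minus a complete bipartite block\<close>

text \<open>The classes \<open>A\<close>, \<open>X - A\<close>, \<open>C\<close>,
  \<open>Y - C\<close> form an equitable partition, so functions constant on classes are mapped to
  such functions.\<close>

lemma signless_apply_product_complement: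
  fixes a b c e :: real
  assumes fin: "finite X" "finite Y" and disj: "X \<inter> Y = {}" and sub: "A \<subseteq> X" "C \<subseteq> Y"
    and v: "v \<in> X \<union> Y"
  shows "signless_apply (sym_edges (X \<times> Y - A \<times> C))
      (\<lambda>v. if v \<in> A then b else if v \<in> X then a else if v \<in> C then e else c) v =
    (if v \<in> A then card (Y - C) * b + card (Y - C) * c
     else if v \<in> X then card Y * a + card (Y - C) * c + card C * e
     else if v \<in> C then card (X - A) * e + card (X - A) * a
     else card X * c + card (X - A) * a + card A * b)"
proof -
  let ?R = "sym_edges (X \<times> Y - A \<times> C)"
  let ?f = "\<lambda>v. if v \<in> A then b else if v \<in> X then a else if v \<in> C then e else c"
  have nb: "?R `` {v} = (if v \<in> A then Y - C else if v \<in> X then Y else if v \<in> C then X - A else X)"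
    using v disj sub by (auto simp: sym_edges_def)
  have sY: "sum ?f (Y - C) = card (Y - C) * c"
    using disj sub by (subst sum.cong[of "Y - C" "Y - C" ?f "\<lambda>_. c"]) auto
  have sC: "sum ?f C = card C * e"
    using disj sub by (subst sum.cong[of C C ?f "\<lambda>_. e"]) auto
  have sX: "sum ?f (X - A) = card (X - A) * a"
    by (subst sum.cong[of "X - A" "X - A" ?f "\<lambda>_. a"]) auto
  have sA: "sum ?f A = card A * b" by simp
  have "sum ?f Y = card (Y - C) * c + card C * e" "sum ?f X = card (X - A) * a + card A * b"
    using sum.subset_diff[OF sub(2) fin(2), of ?f] sum.subset_diff[OF sub(1) fin(1), of ?f] sY sC sX sA
    by simp_all
  then show ?thesis
    unfolding signless_apply_def nb using v sub disj sY sX by auto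
qed

text \<open>Connectedness as absence of proper closed vertex sets: a vertex of \<open>X - A\<close>
  is adjacent to all of \<open>Y\<close>, and one of \<open>Y - C\<close> to all of
  \<open>X\<close>.\<close>

lemma product_complement_connected:
  assumes disj: "X \<inter> Y = {}" and ne: "X - A \<noteq> {}" "Y - C \<noteq> {}"
    and T: "T \<subseteq> X \<union> Y" "T \<noteq> {}" "sym_edges (X \<times> Y - A \<times> C) `` T \<subseteq> T"
  shows "T = X \<union> Y"
proof -
  obtain x y where xy: "x \<in> X" "x \<notin> A" "y \<in> Y" "y \<notin> C" using ne by auto
  have step: "v \<in> T" if "u \<in> T" "(u, v) \<in> X \<times> Y - A \<times> C \<or> (v, u) \<in> X \<times> Y - A \<times> C" for u v
    using that T(3) by (auto simp: sym_edges_def)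
  obtain t where t: "t \<in> T" using T(2) by auto
  have "x \<in> T \<or> y \<in> T"
    using t T(1) xy step[of t x] step[of t y] by auto
  then have "x \<in> T" "y \<in> T" using xy step[of x y] step[of y x] by auto
  moreover have "u \<in> T" if "u \<in> X" "y \<in> T" for u
    using step[OF that(2), of u] that(1) xy by simp
  moreover have "u \<in> T" if "u \<in> Y" "x \<in> T" for u
    using step[OF that(2), of u] that(1) xy by simp
  ultimately show ?thesis using T(1) by blast
qed

lemma ex_bij_betw_pair:
  assumes "finite X" "finite X'" "A \<subseteq> X" "A' \<subseteq> X'" "card X = card X'" "card A = card A'"
  obtains f where "bij_betw f X X'" "f ` A = A'"
proof -
  have fin: "finite A" "finite A'" using assms finite_subset by auto
  then obtain f where f: "bij_betw f A A'" using assms(6) finite_same_card_bij by blast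
  have "card (X - A) = card (X' - A')" using assms fin by (simp add: card_Diff_subset)
  then obtain g where g: "bij_betw g (X - A) (X' - A')"
    using assms finite_same_card_bij[of "X - A" "X' - A'"] by auto
  let ?h = "\<lambda>x. if x \<in> A then f x else g x"
  have "bij_betw ?h (A \<union> (X - A)) (A' \<union> (X' - A'))"
    using f g by (rule bij_betw_disjoint_Un) auto
  moreover have "A \<union> (X - A) = X" "A' \<union> (X' - A') = X'" using assms by auto
  moreover have "?h ` A = A'" using f by (auto simp: bij_betw_def)
  ultimately show ?thesis using that by metis
qed

text \<open>Such a graph is determined by the sizes of its parts and of the missing block: glue
  bijections of the parts that respect the block.\<close>

lemma bigraph_iso_product_complement:
  assumes B: "bipartite_graph B" and B': "bipartite_graph B'"
    and cards: "card (left B) = card (left B')" "card (right B) = card (right B')"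
      "card A = card A'" "card C = card C'"
    and sub: "A \<subseteq> left B" "C \<subseteq> right B" "A' \<subseteq> left B'" "C' \<subseteq> right B'"
    and E: "bedges B = left B \<times> right B - A \<times> C"
    and E': "bedges B' = left B' \<times> right B' - A' \<times> C'"
  shows "B \<cong>\<^sub>b B'"
proof -
  have fin: "finite (left B)" "finite (right B)" "finite (left B')" "finite (right B')"
    and disj: "left B \<inter> right B = {}" "left B' \<inter> right B' = {}"
    using B B' by (auto simp: bipartite_graph_def)
  obtain f where f: "bij_betw f (left B) (left B')" "f ` A = A'"
    using ex_bij_betw_pair[OF fin(1,3) sub(1,3) cards(1,3)] by blast
  obtain g where g: "bij_betw g (right B) (right B')" "g ` C = C'"
    using ex_bij_betw_pair[OF fin(2,4) sub(2,4) cards(2,4)] by blast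
  define h where "h v = (if v \<in> left B then f v else g v)" for v
  have h: "bij_betw h (left B \<union> right B) (left B' \<union> right B')"
    unfolding h_def using f(1) g(1) disj by (rule bij_betw_disjoint_Un)
  then have inj: "inj_on h (left B \<union> right B)" by (simp add: bij_betw_def)
  have "h ` S = f ` S" if "S \<subseteq> left B" for S
    using that by (intro image_cong) (auto simp: h_def)
  moreover have "h ` S = g ` S" if "S \<subseteq> right B" for S
    using that disj by (intro image_cong) (auto simp: h_def)
  ultimately have im: "h ` left B = left B'" "h ` right B = right B'" "h ` A = A'" "h ` C = C'"
    using f g sub by (simp_all add: bij_betw_def)
  have injp: "inj_on (map_prod h h) ((left B \<union> right B) \<times> (left B \<union> right B))"
    using inj by (rule map_prod_inj_on) (rule inj)
  have "map_prod h h ` bedges B = map_prod h h ` (left B \<times> right B) - map_prod h h ` (A \<times> C)"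
    unfolding E using sub by (intro inj_on_image_set_diff[OF injp]) auto
  also have "\<dots> = bedges B'"
    unfolding E' by (simp add: map_prod_surj_on im)
  finally have ime: "map_prod h h ` bedges B = bedges B'" .
  have "map_prod h h ` (R\<inverse>) = (map_prod h h ` R)\<inverse>" for R by force
  with ime have "map_prod h h ` sym_edges (bedges B) = sym_edges (bedges B')"
    by (simp add: sym_edges_def image_Un)
  then have arcs: "map_prod h h ` parcs (graph_of B) = parcs (graph_of B')"
    by (simp add: parcs_graph_of)
  define iso where "iso = \<lparr>iso_verts = h, iso_arcs = map_prod h h, iso_head = snd, iso_tail = fst\<rparr>"
  interpret pair_graph "graph_of B" using B by (rule pair_graph_graph_of)
  have "wf_digraph (with_proj (graph_of B))" by unfold_locales
  moreover have "inj_on (map_prod h h) (parcs (graph_of B))"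
    using injp by (rule inj_on_subset) (use E in \<open>auto simp: parcs_graph_of sym_edges_def\<close>)
  ultimately have "pre_digraph.digraph_isomorphism (with_proj (graph_of B)) iso"
    using inj by (simp add: pre_digraph.digraph_isomorphism_def iso_def pverts_graph_of)
  moreover have "with_proj (graph_of B') = app_iso iso (with_proj (graph_of B))"
    using arcs im by (simp add: with_proj_def app_iso_def iso_def pverts_graph_of image_Un)
  moreover have "{iso_verts iso ` left B, iso_verts iso ` right B} = {left B', right B'}"
    using im by (simp add: iso_def)
  ultimately show ?thesis unfolding bigraph_iso_def by blast
qed

text \<open>In the join only the two parts of the edgeless summand are not joined to each other;
  they serve as \<open>A\<close> and \<open>C\<close>.\<close>

lemma S_graph_product_complement:
  assumes "k < n"
  obtains A C where "A \<subseteq> left (S_graph n k)" "C \<subseteq> right (S_graph n k)"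
    "card A = n - k" "card C = k"
    "card (left (S_graph n k)) = n" "card (right (S_graph n k)) = n - 1"
    "bedges (S_graph n k) = left (S_graph n k) \<times> right (S_graph n k) - A \<times> C"
proof
  let ?A = "Inr ` Inl ` {..<n - k} :: ((nat + nat) + (nat + nat)) set"
  let ?C = "Inr ` Inr ` {..<k} :: ((nat + nat) + (nat + nat)) set"
  have l: "left (S_graph n k) = Inl ` Inl ` {..<k} \<union> ?A"
    and r: "right (S_graph n k) = Inl ` Inr ` {..<n - k - 1} \<union> ?C"
    by (auto simp: S_graph_def bigraph_join_def complete_bigraph_def edgeless_bigraph_def)
  show "?A \<subseteq> left (S_graph n k)" "?C \<subseteq> right (S_graph n k)" unfolding l r by auto
  show "card ?A = n - k" "card ?C = k" by (simp_all add: card_image inj_on_def)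
  have c: "card (Inl ` Inl ` {..<k} :: ((nat + nat) + (nat + nat)) set) = k"
    "card (Inl ` Inr ` {..<n - k - 1} :: ((nat + nat) + (nat + nat)) set) = n - k - 1"
    by (simp_all add: card_image inj_on_def)
  show "card (left (S_graph n k)) = n"
    unfolding l using c assms \<open>card ?A = n - k\<close> by (subst card_Un_disjoint) auto
  show "card (right (S_graph n k)) = n - 1"
    unfolding r using c assms \<open>card ?C = k\<close> by (subst card_Un_disjoint) auto
  show "bedges (S_graph n k) = left (S_graph n k) \<times> right (S_graph n k) - ?A \<times> ?C"
    unfolding l r
    by (auto simp: S_graph_def bigraph_join_def complete_bigraph_def edgeless_bigraph_def image_iff)
qed

lemma product_complement_eigenfunction:
  fixes a b c e q :: real
  assumes fin: "finite X" "finite Y" and disj: "X \<inter> Y = {}" and sub: "A \<subseteq> X" "C \<subseteq> Y"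
    and cards: "card X = n" "card Y + 1 = n" "card A = n - k" "card C = k" and kn: "k < n"
    and eqs: "(real n - 1) * a + (real n - real k - 1) * c + real k * e = q * a"
      "(real n - real k - 1) * b + (real n - real k - 1) * c = q * b"
      "real n * c + real k * a + (real n - real k) * b = q * c"
      "real k * e + real k * a = q * e"
    and v: "v \<in> X \<union> Y"
  shows "signless_apply (sym_edges (X \<times> Y - A \<times> C))
      (\<lambda>v. if v \<in> A then b else if v \<in> X then a else if v \<in> C then e else c) v =
    q * (if v \<in> A then b else if v \<in> X then a else if v \<in> C then e else c)"
proof -
  have "card (X - A) = k" "card (Y - C) = n - k - 1"
    using cards kn sub fin by (simp_all add: card_Diff_subset finite_subset)
  then have "real (card (X - A)) = real k" "real (card (Y - C)) = real n - real k - 1"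
    "real (card Y) = real n - 1" "real (card A) = real n - real k" "real (card X) = real n"
    "real (card C) = real k"
    using cards kn by auto
  then show ?thesis
    unfolding signless_apply_product_complement[OF fin disj sub v] by (simp add: eqs)
qed

lemma hamiltonian_path_traceable:
  assumes "hamiltonian_path (sym_edges (bedges B)) (left B \<union> right B) p"
  shows "traceable (graph_of B)"
proof -
  have "set (vwalk_arcs p) \<subseteq> sym_edges (bedges B)"
    if "successively (\<lambda>u v. (u, v) \<in> sym_edges (bedges B)) p" for p
    using that by (induction p rule: vwalk_arcs.induct) auto
  then have "vpath p (with_proj (graph_of B))" "set p = pverts (graph_of B)"
    using assms
    by (simp_all add: vpath_def vwalk_def hamiltonian_path_def parcs_graph_of pverts_graph_of)
  then show ?thesis unfolding traceable_def by blast
qed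

text \<open>The positive solution \<open>a\<close>, \<open>b\<close>, \<open>c\<close>,
  \<open>e\<close> is used twice: on \<open>S_graph n k\<close> it exhibits an eigenvalue
  \<open>q\<close> above the bound, and on the supergraph of \<open>B\<close> that misses exactly
  \<open>A \<times> C\<close> it is the positive eigenfunction for the rigidity lemma.\<close>

lemma S_graph_q_radius:
  assumes "1 \<le> k" "2 * k + 1 \<le> n"
  shows q_radius_S_graph_gt: "2 * real n - real k - 1 < q_radius (graph_of (S_graph n k))"
    and eq_product_complement_if_q_radius_ge: "\<And>B :: 'a bigraph. bipartite_graph B \<Longrightarrow> card (left B) = n \<Longrightarrow> card (right B) + 1 = n \<Longrightarrow>
      A \<subseteq> left B \<Longrightarrow> C \<subseteq> right B \<Longrightarrow> card A = n - k \<Longrightarrow> card C = k \<Longrightarrow>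
      bedges B \<inter> A \<times> C = {} \<Longrightarrow> q_radius (graph_of (S_graph n k)) \<le> q_radius (graph_of B) \<Longrightarrow>
      bedges B = left B \<times> right B - A \<times> C"
proof -
  let ?S = "S_graph n k"
  have kn: "k < n" using assms by simp
  obtain q a b c e :: real where q: "2 * real n - real k - 1 < q"
    and pos: "0 < a" "0 < b" "0 < c" "0 < e"
    and eqs: "(real n - 1) * a + (real n - real k - 1) * c + real k * e = q * a"
      "(real n - real k - 1) * b + (real n - real k - 1) * c = q * b"
      "real n * c + real k * a + (real n - real k) * b = q * c"
      "real k * e + real k * a = q * e"
    by (rule ex_positive_quotient_eigenvector[of "real k" "real n"]) (use assms in auto)
  obtain A' C' where S: "A' \<subseteq> left ?S" "C' \<subseteq> right ?S" "card A' = n - k" "card C' = k"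
    "card (left ?S) = n" "card (right ?S) = n - 1"
    "bedges ?S = left ?S \<times> right ?S - A' \<times> C'"
    using S_graph_product_complement[OF kn] by blast
  have bS: "bipartite_graph ?S" by (rule bipartite_graph_S_graph)
  then have fS: "finite (left ?S)" "finite (right ?S)" "left ?S \<inter> right ?S = {}"
    by (auto simp: bipartite_graph_def)
  define f where "f v = (if v \<in> A' then b else if v \<in> left ?S then a else if v \<in> C' then e else c)" for v
  have ne: "left ?S \<union> right ?S \<noteq> {}" using S(5) kn by auto
  have "card (right ?S) + 1 = n" using S(6) kn by simp
  then have "\<forall>v\<in>left ?S \<union> right ?S. signless_apply (sym_edges (bedges ?S)) f v = q * f v"
    unfolding S(7) f_def
    using product_complement_eigenfunction[OF fS S(1,2,5) _ S(3,4) kn eqs] by blast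
  moreover have "\<exists>v\<in>left ?S \<union> right ?S. f v \<noteq> 0" using ne pos by (auto simp: f_def)
  ultimately have qS: "q \<le> q_radius (graph_of ?S)"
    using q_radius_ge[OF bS ne] by blast
  then show "2 * real n - real k - 1 < q_radius (graph_of ?S)" using q by linarith
  fix B :: "'a bigraph"
  let ?X = "left B" and ?Y = "right B"
  assume B: "bipartite_graph B" and cX: "card ?X = n" and cY: "card ?Y + 1 = n"
    and sub: "A \<subseteq> ?X" "C \<subseteq> ?Y" and cA: "card A = n - k" and cC: "card C = k"
    and E: "bedges B \<inter> A \<times> C = {}" and ge: "q_radius (graph_of ?S) \<le> q_radius (graph_of B)"
  have fin: "finite ?X" "finite ?Y" and disj: "?X \<inter> ?Y = {}" and BE: "bedges B \<subseteq> ?X \<times> ?Y"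
    using B by (auto simp: bipartite_graph_def)
  have neB: "?X \<union> ?Y \<noteq> {}" using cX kn by auto
  define h where "h v = (if v \<in> A then b else if v \<in> ?X then a else if v \<in> C then e else c)" for v
  let ?E = "?X \<times> ?Y - A \<times> C"
  obtain g where g: "\<exists>v\<in>?X \<union> ?Y. g v \<noteq> 0"
    "\<forall>v\<in>?X \<union> ?Y. signless_apply (sym_edges (bedges B)) g v = q_radius (graph_of B) * g v"
    using q_radius_eigenvalue[OF B neB] by blast
  have "card (?X - A) = k" "card (?Y - C) = n - k - 1"
    using cX cY cA cC kn sub fin by (simp_all add: card_Diff_subset finite_subset)
  then have "card (?X - A) \<noteq> 0" "card (?Y - C) \<noteq> 0" using assms by linarith+
  then have ne: "?X - A \<noteq> {}" "?Y - C \<noteq> {}" by force+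
  have "sym_edges (bedges B) = sym_edges ?E"
  proof (rule subgraph_eq_if_eigenvalue_ge[where f = h, OF _ _ _ _ _ _ g])
    show "finite (?X \<union> ?Y)" using fin by simp
    show "sym_edges (bedges B) \<subseteq> sym_edges ?E" using BE E by (auto simp: sym_edges_def)
    show "sym_edges ?E \<subseteq> (?X \<union> ?Y) \<times> (?X \<union> ?Y)" by (auto simp: sym_edges_def)
    show "T = ?X \<union> ?Y" if "T \<subseteq> ?X \<union> ?Y" "T \<noteq> {}" "sym_edges ?E `` T \<subseteq> T" for T
      using disj ne that by (rule product_complement_connected)
    show "0 < h v" for v using pos by (simp add: h_def)
    show "signless_apply (sym_edges ?E) h v = q * h v" if "v \<in> ?X \<union> ?Y" for v
      unfolding h_def
      using product_complement_eigenfunction[OF fin disj sub cX cY cA cC kn eqs that] .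
    show "q \<le> q_radius (graph_of B)" using qS ge by linarith
  qed
  then have "sym_edges (bedges B) \<inter> ?X \<times> ?Y = sym_edges ?E \<inter> ?X \<times> ?Y" by simp
  moreover have "sym_edges F \<inter> ?X \<times> ?Y = F" if "F \<subseteq> ?X \<times> ?Y" for F
    using that disj by (auto simp: sym_edges_def)
  ultimately show "bedges B = ?E" using BE by (metis Diff_subset)
qed

section \<open>Proof of the theorem\<close>

lemma nontraceable_iso_S_graph:
  fixes B :: "'a bigraph"
  assumes B: "bipartite_graph B" and k: "1 \<le> k" "2 * k + 1 \<le> n"
    and cX: "card (left B) = n" and cY: "card (right B) + 1 = n"
    and deg: "\<And>v. v \<in> left B \<union> right B \<Longrightarrow> k \<le> vdegree (graph_of B) v"
    and conc: "\<And>b. k < b \<Longrightarrow> b < n - k \<Longrightarrow> n * k \<le> b * (n - b)"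
    and wide: "n * k \<le> (k + 1) * (n - k)"
    and q: "q_radius (graph_of (S_graph n k)) \<le> q_radius (graph_of B)"
    and nt: "\<not> traceable (graph_of B)"
  shows "B \<cong>\<^sub>b S_graph n k"
proof -
  let ?X = "left B" and ?Y = "right B" and ?E = "bedges B"
  have fin: "finite ?X" "finite ?Y" and disj: "?X \<inter> ?Y = {}" and E: "?E \<subseteq> ?X \<times> ?Y"
    using B by (auto simp: bipartite_graph_def)
  have kn: "k < n" using k by simp
  have ne: "?X \<union> ?Y \<noteq> {}" using cX kn by auto
  obtain g where g: "\<exists>v\<in>?X \<union> ?Y. g v \<noteq> 0"
    "\<forall>v\<in>?X \<union> ?Y. signless_apply (sym_edges ?E) g v = q_radius (graph_of B) * g v"
    using q_radius_eigenvalue[OF B ne] by blast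
  \<comment> \<open>Sandwich: \<open>q_radius\<close> of \<open>B\<close> is at most
    \<open>n + e / n\<close>, with \<open>e\<close> the number of edges, and exceeds
    \<open>2 * n - k - 1\<close>, so \<open>e\<close> exceeds
    \<open>n * (n - k - 1)\<close>.\<close>
  have "q_radius (graph_of B) \<le> real n + real (card ?E) / real n"
    using cX cY kn by (intro eigenvalue_le_edge_bound[OF fin disj E _ _ _ g]) auto
  then have "real n - real k - 1 < real (card ?E) / real n"
    using q_radius_S_graph_gt[OF k] q by linarith
  then have "real n * (real n - real k - 1) < real (card ?E)"
    using kn by (simp add: field_simps)
  moreover have "real n - real k - 1 = real (n - k - 1)" using kn by simp
  ultimately have many: "n * (n - k - 1) < card ?E"
    by (metis of_nat_less_iff of_nat_mult)
  have nopath: "\<nexists>p. hamiltonian_path (sym_edges ?E) (?X \<union> ?Y) p"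
    using nt hamiltonian_path_traceable by blast
  have degX: "k \<le> card (?E `` {x})" if "x \<in> ?X" for x
    using deg[of x] that sym_edges_Image_left[OF E disj that] by (simp add: vdegree_graph_of)
  have degY: "k \<le> card (?E\<inverse> `` {y})" if "y \<in> ?Y" for y
    using deg[of y] that sym_edges_Image_right[OF E disj that] by (simp add: vdegree_graph_of)
  obtain A C where AC: "A \<subseteq> ?X" "C \<subseteq> ?Y" "card A = n - k" "card C = k" "?E \<inter> A \<times> C = {}"
    by (rule nontraceable_misses_product[OF fin disj cX cY E nopath kn many degX degY conc wide])
  have BE: "?E = ?X \<times> ?Y - A \<times> C"
    using eq_product_complement_if_q_radius_ge[OF k B cX cY AC q] .
  obtain A' C' where S: "A' \<subseteq> left (S_graph n k)" "C' \<subseteq> right (S_graph n k)"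
    "card A' = n - k" "card C' = k"
    "card (left (S_graph n k)) = n" "card (right (S_graph n k)) = n - 1"
    "bedges (S_graph n k) = left (S_graph n k) \<times> right (S_graph n k) - A' \<times> C'"
    using S_graph_product_complement[OF kn] by blast
  show ?thesis
    by (rule bigraph_iso_product_complement[OF B bipartite_graph_S_graph _ _ _ _ AC(1,2) S(1,2) BE S(7)])
      (use S AC cX cY in simp_all)
qed

text \<open>Without an isolated vertex \<open>2 * n - 2\<close> vertices remain, which bounds the
  spectral radius, whereas that of \<open>S_graph n 1\<close> exceeds
  \<open>2 * n - 2\<close>.\<close>

lemma no_isolated_vertex:
  fixes B :: "'a bigraph"
  assumes B: "bipartite_graph B" and n: "3 \<le> n"
    and cX: "card (left B) = n" and cY: "card (right B) + 1 = n"
    and q: "q_radius (graph_of (S_graph n 1)) \<le> q_radius (graph_of B)"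
    and v: "v \<in> left B \<union> right B"
  shows "1 \<le> vdegree (graph_of B) v"
proof (rule ccontr)
  let ?X = "left B" and ?Y = "right B" and ?E = "bedges B"
  assume "\<not> ?thesis"
  then have "card (sym_edges ?E `` {v}) = 0" by (simp add: vdegree_graph_of)
  have fin: "finite ?X" "finite ?Y" and disj: "?X \<inter> ?Y = {}" and E: "?E \<subseteq> ?X \<times> ?Y"
    using B by (auto simp: bipartite_graph_def)
  have "finite (sym_edges ?E `` {v})"
    by (rule finite_subset[of _ "?X \<union> ?Y"]) (use E fin in \<open>auto simp: sym_edges_def\<close>)
  with \<open>card _ = 0\<close> have "sym_edges ?E `` {v} = {}" by simp
  then have E': "?E \<subseteq> (?X - {v}) \<times> (?Y - {v})" using E by (auto simp: sym_edges_def)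
  obtain g where g: "\<exists>v\<in>?X \<union> ?Y. g v \<noteq> 0"
    "\<forall>v\<in>?X \<union> ?Y. signless_apply (sym_edges ?E) g v = q_radius (graph_of B) * g v"
    using q_radius_eigenvalue[OF B] v by blast
  have "q_radius (graph_of B) \<le> real (card (?X - {v}) + card (?Y - {v}))"
    by (rule eigenvalue_le_order_bound[OF _ _ _ _ E' g]) (use fin disj in auto)
  moreover have "card (?X - {v}) + card (?Y - {v}) = 2 * n - 2"
    using v fin disj cX cY n by (auto simp: card_Diff_singleton_if disjoint_iff)
  moreover have "real (2 * n - 2) = 2 * real n - 2" using n by simp
  ultimately show False using q_radius_S_graph_gt[of 1 n] n q by simp
qed

text \<open>By concavity \<open>b * (n - b)\<close> is smallest at the ends \<open>k + 1\<close> and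
  \<open>n - k - 1\<close>, and its value there is at least \<open>n * k\<close> exactly when
  \<open>(k + 1)^2 \<le> n\<close>.\<close>

lemma product_ge_if_square_le:
  fixes n k :: nat
  assumes "1 \<le> k" "(k + 1)\<^sup>2 \<le> n"
  shows "2 * k + 1 \<le> n" "n * k \<le> (k + 1) * (n - k)"
    "\<And>b. k < b \<Longrightarrow> b < n - k \<Longrightarrow> n * k \<le> b * (n - b)"
proof -
  have sq: "(k + 1) * (k + 1) \<le> n" using assms(2) by (simp add: power2_eq_square)
  moreover have "(k + 1) * (k + 1) = k * k + 2 * k + 1" by (simp add: algebra_simps)
  ultimately show kn: "2 * k + 1 \<le> n" by linarith
  have sqi: "(int k + 1) * (int k + 1) \<le> int n"
    using of_nat_mono[OF sq, where 'a = int] by (simp only: of_nat_mult of_nat_add of_nat_1)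
  have nk: "int (n - k) = int n - int k" using kn by (simp add: of_nat_diff)
  have "int n * int k \<le> (int k + 1) * (int n - int k)"
    using sqi by (simp add: algebra_simps)
  then have "int (n * k) \<le> int ((k + 1) * (n - k))"
    by (simp only: of_nat_mult of_nat_add of_nat_1 nk)
  then show "n * k \<le> (k + 1) * (n - k)" by (simp only: of_nat_le_iff)
  fix b assume b: "k < b" "b < n - k"
  have nb: "int (n - b) = int n - int b" using b by (simp add: of_nat_diff)
  \<comment> \<open>This product equals \<open>b * (n - b) - (k + 1) * (n - k - 1)\<close>; the
    integers avoid truncated subtraction.\<close>
  have "0 \<le> (int b - int k - 1) * (int n - int k - 1 - int b)"
    using b by (intro mult_nonneg_nonneg) auto
  then have "int n * int k \<le> int b * (int n - int b)"
    using sqi by (simp add: algebra_simps)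
  then have "int (n * k) \<le> int (b * (n - b))" by (simp only: of_nat_mult nb)
  then show "n * k \<le> b * (n - b)" by (simp only: of_nat_le_iff)
qed

lemma traceable_or_iso_S_graph:
  fixes B :: "'a bigraph"
  assumes n: "(k + 1)\<^sup>2 \<le> n" and B: "bipartite_graph B"
    and cX: "card (left B) = n" and cY: "card (right B) + 1 = n"
    and deg: "k \<le> min_degree (graph_of B)"
  shows "1 \<le> k \<Longrightarrow> q_radius (graph_of (S_graph n k)) \<le> q_radius (graph_of B) \<Longrightarrow>
      traceable (graph_of B) \<or> B \<cong>\<^sub>b S_graph n k"
    and "3 \<le> n \<Longrightarrow> q_radius (graph_of (S_graph n 1)) \<le> q_radius (graph_of B) \<Longrightarrow>
      traceable (graph_of B) \<or> B \<cong>\<^sub>b S_graph n 1"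
proof -
  have "finite (vdegree (graph_of B) ` pverts (graph_of B))"
    using B by (simp add: bipartite_graph_def pverts_graph_of)
  then have d: "k \<le> vdegree (graph_of B) v" if "v \<in> left B \<union> right B" for v
    using deg that Min_le unfolding min_degree_def pverts_graph_of by (meson image_eqI le_trans)
  show "traceable (graph_of B) \<or> B \<cong>\<^sub>b S_graph n k"
    if "1 \<le> k" "q_radius (graph_of (S_graph n k)) \<le> q_radius (graph_of B)"
    using nontraceable_iso_S_graph[OF B that(1) product_ge_if_square_le(1)[OF that(1) n] cX cY d
        product_ge_if_square_le(3,2)[OF that(1) n] that(2)]
    by (cases "traceable (graph_of B)") simp_all
  show "traceable (graph_of B) \<or> B \<cong>\<^sub>b S_graph n 1"
    if n3: "3 \<le> n" and q: "q_radius (graph_of (S_graph n 1)) \<le> q_radius (graph_of B)"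
  proof -
    have wide: "n * 1 \<le> (1 + 1) * (n - 1)" using n3 by simp
    \<comment> \<open>For \<open>n = 3\<close> the range of \<open>b\<close> is empty; otherwise
      \<open>n\<close> is at least \<open>4 = (1 + 1)^2\<close>.\<close>
    have conc: "n * 1 \<le> b * (n - b)" if "1 < b" "b < n - 1" for b
    proof -
      have "4 \<le> n" using that by simp
      then show ?thesis using product_ge_if_square_le(3)[of 1 n b] that by (simp add: power2_eq_square)
    qed
    have "2 * 1 + 1 \<le> n" using n3 by simp
    from nontraceable_iso_S_graph[OF B order_refl this cX cY no_isolated_vertex[OF B n3 cX cY q] conc wide q]
    show ?thesis by (cases "traceable (graph_of B)") simp_all
  qed
qed

section \<open>Interchange of the two parts\<close>

text \<open>Makes the larger part the left one. The underlying graph does not change, so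
  traceability, minimum degree and spectral radius carry over.\<close>

definition swap_parts :: "'a bigraph \<Rightarrow> 'a bigraph" where
  "swap_parts B = \<lparr>left = right B, right = left B, bedges = (bedges B)\<inverse>\<rparr>"

lemma graph_of_swap_parts: "graph_of (swap_parts B) = graph_of B"
  by (simp add: graph_of_def swap_parts_def Un_commute)

lemma swap_parts_iso: "swap_parts B \<cong>\<^sub>b C \<Longrightarrow> B \<cong>\<^sub>b C"
  unfolding bigraph_iso_def graph_of_swap_parts by (simp add: swap_parts_def insert_commute)

theorem theorem2p6:
  fixes k n :: nat and G :: "'a bigraph"
  assumes "n \<ge> (k + 1)\<^sup>2"
    and "bipartite_graph G"
    and "nearly_balanced G"
    and "card (pverts (graph_of G)) = 2 * n - 1"
    and "min_degree (graph_of G) \<ge> k"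
  shows "(k \<ge> 1 \<and> q_radius (graph_of G) \<ge> q_radius (graph_of (S_graph n k)) \<longrightarrow>
            traceable (graph_of G) \<or> G \<cong>\<^sub>b S_graph n k) \<and>
         (k = 0 \<and> n \<ge> 3 \<and> q_radius (graph_of G) \<ge> q_radius (graph_of (S_graph n 1)) \<longrightarrow>
            traceable (graph_of G) \<or> G \<cong>\<^sub>b S_graph n 1)"
proof -
  \<comment> \<open>Positivity of \<open>n\<close> keeps \<open>2 * n - 1\<close> from truncating,
    so the parts have sizes \<open>n\<close> and \<open>n - 1\<close>.\<close>
  have "0 < (k + 1)\<^sup>2" by simp
  then have "1 \<le> n" using assms(1) by linarith
  moreover have "card (left G) + card (right G) = 2 * n - 1"
    using assms(2,4) by (simp add: bipartite_graph_def pverts_graph_of card_Un_disjoint)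
  ultimately consider "card (left G) = n" "card (right G) + 1 = n"
    | "card (right G) = n" "card (left G) + 1 = n"
    using assms(3) unfolding nearly_balanced_def by linarith
  then show ?thesis
  proof cases
    case 1
    then show ?thesis using traceable_or_iso_S_graph[OF assms(1,2) 1 assms(5)] by blast
  next
    case 2
    have "bipartite_graph (swap_parts G)"
      using assms(2) by (auto simp: bipartite_graph_def swap_parts_def)
    moreover have "card (left (swap_parts G)) = n" "card (right (swap_parts G)) + 1 = n"
      using 2 by (simp_all add: swap_parts_def)
    ultimately show ?thesis
      using traceable_or_iso_S_graph[OF assms(1), of "swap_parts G"] assms(5) swap_parts_iso[of G]
      unfolding graph_of_swap_parts by blast
  qed
qed

end
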